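(* Let $N\ge 1$ and $n=N+1$. Let $\mathcal{F}\subset\mathbb{R}^{N}$ be the set of admissible vectors of fidelities $(F_{12},\ldots,F_{1n})$ for $1\to N$ universal qubit cloning, i.e. the set of all vectors $(F_{12}(\rho),\ldots,F_{1n}(\rho))$ where $\rho$ ranges over density operators on $(\mathbb{C}^2)^{\otimes n}$ whose first one-qubit marginal is $I/2$. Then $$\mathcal{F}=\operatorname{conv}\Big(\bigcup_{\lambda}\mathcal{F}^{\lambda}\Big),$$ where $\operatorname{conv}$ denotes the convex hull, the union runs over all irreducible representations of $S_n$ occurring in $(\mathbb{C}^2)^{\otimes n}$, i.e. over all partitions $\lambda$ of $n$ with at most two nonzero parts, and $$\mathcal{F}^{\lambda}=\Big\{\big(F^{\lambda}_{12},\ldots,F^{\lambda}_{1n}\big)\ :\ F^{\lambda}_{1k}=\tfrac12-\tfrac12\langle\psi|\widetilde{V}^{\lambda}_{(1k)}|\psi\rangle\ (k=2,\ldots,n),\ |\psi\rangle\in\mathbb{C}^{d_\lambda},\ \langle\psi|\psi\rangle=1\Big\}.$$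
   Context: A density operator (state) is a positive semidefinite operator of trace $1$. The $n$ tensor factors of $(\mathbb{C}^2)^{\otimes n}$ are labelled $1,\ldots,n$. For a state $\rho$ on $(\mathbb{C}^2)^{\otimes n}$ and $2\le k\le n$, the fidelity (singlet fraction) is $$F_{1k}(\rho)=\langle\psi^-|\operatorname{Tr}_{\overline{1k}}(\rho)|\psi^-\rangle,\qquad |\psi^-\rangle=\tfrac{1}{\sqrt2}(|01\rangle-|10\rangle),$$ where $\operatorname{Tr}_{\overline{1k}}$ is the partial trace over all factors except $1$ and $k$. States with first marginal $I/2$ are exactly the states $(\mathrm{id}\otimes\widetilde\Lambda)(|\psi^-\rangle\langle\psi^-|)$ with $\widetilde\Lambda$ a completely positive trace-preserving map (the cloning machine) from one qubit to $N$ qubits. For a partition $\lambda$ of $n$, $\widetilde{V}^{\lambda}$ denotes the irreducible unitary representation of $S_n$ labelled by $\lambda$, acting on $\mathbb{C}^{d_\lambda}$ where $d_\lambda$ is its dimension; $\lambda=(n)$ is the trivial representation. $(1k)\in S_n$ is the transposition exchanging $1$ and $k$. By Schur–Weyl duality, the representation of $S_n$ on $(\mathbb{C}^2)^{\otimes n}$ by permutation of tensor factors decomposes as $\bigoplus_{\lambda} I_{r(\lambda)}\otimes\widetilde V^{\lambda}_{\pi}$, with $\lambda$ running over partitions of $n$ with at most two nonzero parts. *)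

theory Defs
  imports
    "HOL-Analysis.Analysis"
    "HOL-Algebra.Sym_Groups"
    "HOL-Combinatorics.Permutations"
    "Jordan_Normal_Form.Schur_Decomposition"
    "Jordan_Normal_Form.VS_Connect"
begin

section \<open>Qubit systems\<close>

text \<open>
  The space of \<open>n\<close> qubits is \<open>carrier_vec (2 ^ n)\<close>; the basis vector number \<open>i\<close> is
  \<open>|b\<^sub>1 b\<^sub>2 \<dots>\<rangle>\<close> where the \<open>b\<^sub>l\<close> are the binary digits of \<open>i\<close>, most significant one first.
  Thus \<open>qubit n i l\<close> is the digit of tensor factor \<open>l\<close>, for \<open>l\<close> in \<open>{1..n}\<close>.

  Since \<open>v \<bullet>c w\<close> is conjugate-linear in \<open>w\<close>, the bracket of \<open>\<psi>\<close>, \<open>A\<close>, \<open>\<psi>\<close> is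
  \<open>(A *\<^sub>v \<psi>) \<bullet>c \<psi>\<close>.
\<close>

definition qubit :: "nat \<Rightarrow> nat \<Rightarrow> nat \<Rightarrow> bool" where
  "qubit n i l = bit i (n - l)"

definition expval :: "complex mat \<Rightarrow> complex vec \<Rightarrow> complex" where
  "expval A \<psi> = (A *\<^sub>v \<psi>) \<bullet>c \<psi>"

text \<open>
  In the order on complex numbers, \<open>0 \<le> z\<close> means that \<open>z\<close> is real and nonnegative.
\<close>

definition density_operator :: "nat \<Rightarrow> complex mat \<Rightarrow> bool" where
  "density_operator m \<rho> \<longleftrightarrow>
     \<rho> \<in> carrier_mat m m \<and>
     (\<forall>v \<in> carrier_vec m. 0 \<le> expval \<rho> v) \<and>
     (\<Sum>i<m. \<rho> $$ (i, i)) = 1"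

text \<open>
  \<open>partial_trace n ks \<rho>\<close> traces out all factors not in \<open>ks\<close>; the entry of \<open>ks\<close> at position \<open>l\<close>
  becomes tensor factor \<open>Suc l\<close> of the reduced operator.
\<close>

definition partial_trace :: "nat \<Rightarrow> nat list \<Rightarrow> complex mat \<Rightarrow> complex mat" where
  "partial_trace n ks \<rho> =
     mat (2 ^ length ks) (2 ^ length ks) (\<lambda>(a, b).
       \<Sum>(i, j) \<in> {(i, j). i < 2 ^ n \<and> j < 2 ^ n \<and>
           (\<forall>l < length ks. qubit n i (ks ! l) = qubit (length ks) a (Suc l)) \<and>
           (\<forall>l < length ks. qubit n j (ks ! l) = qubit (length ks) b (Suc l)) \<and>
           (\<forall>l \<in> {1..n} - set ks. qubit n i l = qubit n j l)}.
         \<rho> $$ (i, j))"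

definition singlet :: "complex vec" where
  "singlet = vec_of_list [0, 1 / complex_of_real (sqrt 2), - 1 / complex_of_real (sqrt 2), 0]"

text \<open>The bracket below is real for every density operator.\<close>

definition fidelity :: "nat \<Rightarrow> nat \<Rightarrow> complex mat \<Rightarrow> real" where
  "fidelity n k \<rho> = Re (expval (partial_trace n [1, k] \<rho>) singlet)"

text \<open>
  A vector of fidelities has one coordinate for each factor in \<open>{2..n}\<close>. The coordinates are
  indexed by a finite type, and \<open>lbl\<close> tells to which factor a coordinate belongs.
\<close>

definition admissible_fidelities :: "nat \<Rightarrow> ('N::finite \<Rightarrow> nat) \<Rightarrow> (real ^ 'N) set" where
  "admissible_fidelities n lbl =
     {(\<chi> a. fidelity n (lbl a) \<rho>) | \<rho>.
        density_operator (2 ^ n) \<rho> \<and> partial_trace n [1] \<rho> = (1 / 2) \<cdot>\<^sub>m 1\<^sub>m 2}"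


section \<open>Irreducible representations of the symmetric group\<close>

definition unitary_mat :: "nat \<Rightarrow> complex mat \<Rightarrow> bool" where
  "unitary_mat d U \<longleftrightarrow> U \<in> carrier_mat d d \<and> mat_adjoint U * U = 1\<^sub>m d"

definition unitary_rep :: "nat \<Rightarrow> nat \<Rightarrow> ((nat \<Rightarrow> nat) \<Rightarrow> complex mat) \<Rightarrow> bool" where
  "unitary_rep n d V \<longleftrightarrow>
     V \<in> hom (sym_group n) (ring_mat TYPE(complex) d ()) \<and>
     (\<forall>p \<in> carrier (sym_group n). unitary_mat d (V p))"

definition irreducible_rep :: "nat \<Rightarrow> nat \<Rightarrow> ((nat \<Rightarrow> nat) \<Rightarrow> complex mat) \<Rightarrow> bool" where
  "irreducible_rep n d V \<longleftrightarrow>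
     0 < d \<and>
     (\<forall>W. VectorSpace.subspace class_ring W (module_vec TYPE(complex) d) \<and>
          (\<forall>p \<in> carrier (sym_group n). \<forall>w \<in> W. V p *\<^sub>v w \<in> W)
        \<longrightarrow> W = {0\<^sub>v d} \<or> W = carrier_vec d)"

definition partitions :: "nat \<Rightarrow> nat list set" where
  "partitions n = {\<mu>. sorted_wrt (\<ge>) \<mu> \<and> 0 \<notin> set \<mu> \<and> sum_list \<mu> = n}"

definition two_row_partitions :: "nat \<Rightarrow> nat list set" where
  "two_row_partitions n = {\<mu> \<in> partitions n. length \<mu> \<le> 2}"

text \<open>
  The irreducible representation labelled by a partition is its Specht module, the span of the
  polytabloids. A tableau is the list of its rows, a tabloid is the list of the sets of entries
  of the rows, and an element of the permutation module on tabloids is a function from tabloids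
  to scalars.
\<close>

definition tableaux :: "nat \<Rightarrow> nat list \<Rightarrow> nat list list set" where
  "tableaux n \<mu> = {t. map length t = \<mu> \<and> distinct (concat t) \<and> set (concat t) = {1..n}}"

definition tabloid :: "nat list list \<Rightarrow> nat set list" where
  "tabloid t = map set t"

definition tableau_column :: "nat list list \<Rightarrow> nat \<Rightarrow> nat set" where
  "tableau_column t j = {row ! j | row. row \<in> set t \<and> j < length row}"

definition column_stabilizer :: "nat \<Rightarrow> nat list list \<Rightarrow> (nat \<Rightarrow> nat) set" where
  "column_stabilizer n t =
     {p \<in> carrier (sym_group n). \<forall>j. p ` tableau_column t j = tableau_column t j}"

definition polytabloid :: "nat \<Rightarrow> nat list list \<Rightarrow> nat set list \<Rightarrow> complex" where
  "polytabloid n t T =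
     (\<Sum>p \<in> column_stabilizer n t.
        of_int (sign p) * (if T = tabloid (map (map p) t) then 1 else 0))"

definition specht :: "nat \<Rightarrow> nat list \<Rightarrow> (nat set list \<Rightarrow> complex) set" where
  "specht n \<mu> = {(\<lambda>T. \<Sum>t \<in> tableaux n \<mu>. c t * polytabloid n t T) | c. True}"

text \<open>
  The action sends the indicator function of a tabloid to that of its image under \<open>p\<close>; hence
  the preimage under \<open>p\<close> in the argument.
\<close>

definition tabloid_action ::
    "(nat \<Rightarrow> nat) \<Rightarrow> (nat set list \<Rightarrow> complex) \<Rightarrow> (nat set list \<Rightarrow> complex)" where
  "tabloid_action p f = (\<lambda>T. f (map (vimage p) T))"

definition equivalent_to_specht ::
    "nat \<Rightarrow> nat list \<Rightarrow> nat \<Rightarrow> ((nat \<Rightarrow> nat) \<Rightarrow> complex mat) \<Rightarrow> bool" where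
  "equivalent_to_specht n \<mu> d V \<longleftrightarrow>
     (\<exists>\<Phi>. bij_betw \<Phi> (carrier_vec d) (specht n \<mu>) \<and>
        (\<forall>v \<in> carrier_vec d. \<forall>w \<in> carrier_vec d. \<Phi> (v + w) = (\<lambda>T. \<Phi> v T + \<Phi> w T)) \<and>
        (\<forall>c. \<forall>v \<in> carrier_vec d. \<Phi> (c \<cdot>\<^sub>v v) = (\<lambda>T. c * \<Phi> v T)) \<and>
        (\<forall>p \<in> carrier (sym_group n). \<forall>v \<in> carrier_vec d.
           \<Phi> (V p *\<^sub>v v) = tabloid_action p (\<Phi> v)))"

definition irrep_labelled_by ::
    "nat \<Rightarrow> nat list \<Rightarrow> nat \<Rightarrow> ((nat \<Rightarrow> nat) \<Rightarrow> complex mat) \<Rightarrow> bool" where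
  "irrep_labelled_by n \<mu> d V \<longleftrightarrow>
     unitary_rep n d V \<and> irreducible_rep n d V \<and> equivalent_to_specht n \<mu> d V"

text \<open>
  The bracket below is real, since a unitary representation maps a transposition to a
  self-adjoint matrix.
\<close>

definition irrep_fidelities ::
    "('N::finite \<Rightarrow> nat) \<Rightarrow> nat \<Rightarrow> ((nat \<Rightarrow> nat) \<Rightarrow> complex mat) \<Rightarrow> (real ^ 'N) set" where
  "irrep_fidelities lbl d V =
     {(\<chi> a. 1 / 2 - 1 / 2 * Re (expval (V (Transposition.transpose 1 (lbl a))) \<psi>)) | \<psi>.
        \<psi> \<in> carrier_vec d \<and> \<psi> \<bullet>c \<psi> = 1}"

end

theory Submission
  imports Defs "Jordan_Normal_Form.Spectral_Radius"
begin

text \<open>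
  A computational basis vector of \<open>n\<close> qubits is the set \<open>S\<close> of the tensor factors carrying the
  digit 1, and also the tabloid with rows \<open>{1..n} - S\<close> and \<open>S\<close>. So vectors are functions on subsets of
  \<open>{1..n}\<close>, and those supported on \<open>k\<close>-element sets form the permutation module of shape \<open>(n - k, k)\<close>.

  Since the projection to the singlet is half of identity minus swap, fidelities of a pure state
  \<open>f\<close> are expectations of transpositions, and a general state is a sum of rank-one operators.
  With the raising operator \<open>U\<close> and its adjoint \<open>D\<close>, a \<open>k\<close>-homogeneous function that \<open>D\<close> annihilates
  and that is orthogonal to all polytabloids vanishes, so every \<open>k\<close>-homogeneous function is \<open>g + U f\<close>
  with \<open>g\<close> in the Specht module. As \<open>D U - U D\<close> is scalar on homogeneous functions, \<open>U\<^sup>i g\<close> is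
  orthogonal to everything in the image of \<open>U\<^sup>i\<^sup>+\<^sup>1\<close>; hence iterating splits \<open>f\<close> orthogonally into
  images of Specht modules under powers of \<open>U\<close>, on each of which the fidelities are, by Schur's lemma,
  a nonnegative multiple of those of the irreducible representation.

  Conversely, a unit vector of the Specht module is a pure state; its equal mixture with the state
  obtained by flipping all qubits has first marginal \<open>I/2\<close> and the same fidelities.
\<close>

section \<open>Functions on the subsets of a finite set\<close>

text \<open>Why a function that passes both tests vanishes: its inner product with a polytabloid is
  an alternating sum \<open>alt_sum f ps {}\<close>, which chooses one member from each pair of a
  list, with a minus sign for each second member. These sums are extended by a set \<open>C\<close>
  of elements that are always present. With \<open>C\<close> empty they express orthogonality to
  polytabloids; with no pairs left they are the values of the function. One passes from the former
  to the latter by replacing one pair at a time by one element of \<open>C\<close>, and each such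
  replacement uses that \<open>lower\<close> annihilates the function. The degree is not restricted
  to at most n/2: above that bound there are no lists of k disjoint pairs, so the Specht part is
  simply zero. A power of \<open>upper\<close> rescales a Specht module and may annihilate it.
  Therefore nothing is normalised along the way: each fidelity vector is carried together with its
  weight, the squared norm, and weight zero is allowed.\<close>

fun alt_sum :: "('a set \<Rightarrow> complex) \<Rightarrow> ('a \<times> 'a) list \<Rightarrow> 'a set \<Rightarrow> complex" where
  "alt_sum f [] C = f C"
| "alt_sum f ((a, b) # ps) C = alt_sum f ps (insert a C) - alt_sum f ps (insert b C)"

text \<open>Disjoint pairs of distinct elements: the columns of length two of a two-row
  tableau.\<close>

fun pairing :: "'a set \<Rightarrow> ('a \<times> 'a) list \<Rightarrow> bool" where
  "pairing X [] \<longleftrightarrow> True"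
| "pairing X ((a, b) # ps) \<longleftrightarrow> a \<in> X \<and> b \<in> X \<and> a \<noteq> b \<and> pairing (X - {a, b}) ps"

text \<open>\<open>lower\<close> and \<open>upper\<close> are the ladder operators of the total
  spin, the operators D and U of the overview. The value off the subsets of \<open>X\<close> is set
  to zero so that identities hold as equalities of functions.\<close>

definition lower :: "'a set \<Rightarrow> ('a set \<Rightarrow> complex) \<Rightarrow> 'a set \<Rightarrow> complex" where
  "lower X f S = (if S \<subseteq> X then \<Sum>z\<in>X - S. f (insert z S) else 0)"

definition upper :: "'a set \<Rightarrow> ('a set \<Rightarrow> complex) \<Rightarrow> 'a set \<Rightarrow> complex" where
  "upper X f S = (if S \<subseteq> X then \<Sum>y\<in>S. f (S - {y}) else 0)"

definition fun_inner :: "'a set \<Rightarrow> ('a set \<Rightarrow> complex) \<Rightarrow> ('a set \<Rightarrow> complex) \<Rightarrow> complex" where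
  "fun_inner X f g = (\<Sum>S\<in>Pow X. f S * cnj (g S))"

definition pair_elems :: "('a \<times> 'a) list \<Rightarrow> 'a set" where
  "pair_elems ps = fst ` set ps \<union> snd ` set ps"

lemma pair_elems_simps [simp]: "pair_elems [] = {}" "pair_elems ((a, b) # ps) = insert a (insert b (pair_elems ps))"
  by (auto simp: pair_elems_def)

lemma finite_pair_elems [simp]: "finite (pair_elems ps)"
  by (auto simp: pair_elems_def)

lemma pairing_subset: "pairing X ps \<Longrightarrow> pair_elems ps \<subseteq> X"
  by (induction X ps rule: pairing.induct) auto

lemma pairing_iff:
  "pairing X ps \<longleftrightarrow> distinct (map fst ps @ map snd ps) \<and> pair_elems ps \<subseteq> X"
  by (induction X ps rule: pairing.induct) (auto simp: pair_elems_def)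

lemma card_pair_elems:
  assumes "pairing X ps"
  shows "card (pair_elems ps) = 2 * length ps"
proof -
  have "pair_elems ps = set (map fst ps @ map snd ps)" by (auto simp: pair_elems_def)
  moreover have "distinct (map fst ps @ map snd ps)" using assms by (simp add: pairing_iff)
  ultimately show ?thesis using distinct_card[of "map fst ps @ map snd ps"] by simp
qed

lemma finite_pairings:
  assumes "finite X"
  shows "finite {ps. pairing X ps \<and> length ps = k}"
proof (rule finite_subset)
  show "{ps. pairing X ps \<and> length ps = k} \<subseteq> {ps. set ps \<subseteq> X \<times> X \<and> length ps = k}"
    using pairing_subset by (fastforce simp: pair_elems_def)
  show "finite {ps. set ps \<subseteq> X \<times> X \<and> length ps = k}"
    using assms by (intro finite_lists_length_eq) auto
qed

text \<open>
  Terms in which both members of a pair occur cancel, which is why it suffices to sum over the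
  elements that occur in no pair.
\<close>

lemma sum_alt_sum_eq_0:
  assumes "finite X" "\<And>S. S \<subseteq> X \<Longrightarrow> Suc (card S) = k \<Longrightarrow> lower X f S = 0"
    and "pairing (X - C) ps" "C \<subseteq> X" "Suc (card C + length ps) = k"
  shows "(\<Sum>z\<in>X - C - pair_elems ps. alt_sum f ps (insert z C)) = 0"
  using assms(3-)
proof (induction ps arbitrary: C)
  case Nil
  then show ?case
    using assms(2)[of C] by (simp add: lower_def)
next
  case (Cons p ps)
  obtain a b where p: "p = (a, b)" by force
  have fin: "finite C" using Cons.prems assms(1) finite_subset by blast
  have ab: "a \<in> X" "b \<in> X" "a \<notin> C" "b \<notin> C" "a \<noteq> b" "pairing (X - C - {a, b}) ps"
    using Cons.prems by (auto simp: p)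
  have ne: "a \<notin> pair_elems ps" "b \<notin> pair_elems ps"
    using pairing_subset[OF ab(6)] by auto
  \<comment> \<open>The induction hypothesis for \<open>insert u C\<close> sums over one more free
    element, namely \<open>v\<close>. Moving that term to the right leaves the set
    \<open>insert v (insert u C)\<close>, which is the same for both choices of \<open>u\<close>, so
    the two remainders cancel in the difference.\<close>
  have *: "(\<Sum>z\<in>X - C - pair_elems (p # ps). alt_sum f ps (insert z (insert u C)))
      = - alt_sum f ps (insert v (insert u C))"
    if uv: "(u, v) = (a, b) \<or> (u, v) = (b, a)" for u v
  proof -
    have "pairing (X - insert u C) ps"
      using ab(6) uv by (auto simp: pairing_iff)
    then have "(\<Sum>z\<in>X - insert u C - pair_elems ps. alt_sum f ps (insert z (insert u C))) = 0"
      using Cons.prems ab uv fin by (intro Cons.IH) auto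
    moreover have "X - insert u C - pair_elems ps = insert v (X - C - pair_elems (p # ps))"
      using uv ab ne by (auto simp: p)
    moreover have "v \<notin> X - C - pair_elems (p # ps)" using uv by (auto simp: p)
    ultimately show ?thesis
      using assms(1) by (simp add: eq_neg_iff_add_eq_0 add.commute)
  qed
  have "(\<Sum>z\<in>X - C - pair_elems (p # ps). alt_sum f (p # ps) (insert z C))
     = (\<Sum>z\<in>X - C - pair_elems (p # ps). alt_sum f ps (insert z (insert a C)))
     - (\<Sum>z\<in>X - C - pair_elems (p # ps). alt_sum f ps (insert z (insert b C)))"
    unfolding sum_subtractf[symmetric] p alt_sum.simps by (simp add: insert_commute)
  then show ?case
    using *[of a b] *[of b a] by (simp add: insert_commute)
qed

lemma alt_sum_append:
  "alt_sum f (ps @ [(a, b)]) C = alt_sum f ps (insert a C) - alt_sum f ps (insert b C)"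
  by (induction f ps C rule: alt_sum.induct) (auto simp: insert_commute)

text \<open>Induction on the size of \<open>C\<close>. Exchanging an element \<open>x\<close> of
  \<open>C\<close> for a free \<open>z\<close> changes the sum by the alternating sum with the
  additional pair \<open>(x, z)\<close>, which vanishes by induction. So the sum does not depend on
  \<open>z\<close>; its total over all free \<open>z\<close> is zero by the previous cancellation,
  and \<open>x\<close> itself is one of them. An empty \<open>ps\<close> gives
  \<open>f C = 0\<close>.\<close>

lemma alt_sum_eq_0_all_lengths:
  assumes "finite X" "\<And>S. S \<subseteq> X \<Longrightarrow> Suc (card S) = k \<Longrightarrow> lower X f S = 0"
    and "\<And>ps. pairing X ps \<Longrightarrow> length ps = k \<Longrightarrow> alt_sum f ps {} = 0"
    and "pairing (X - C) ps" "C \<subseteq> X" "card C + length ps = k"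
  shows "alt_sum f ps C = 0"
  using assms(4-)
proof (induction "card C" arbitrary: C ps)
  case 0
  then have "C = {}"
    using assms(1) finite_subset by fastforce
  then show ?case using 0 assms(3) by simp
next
  case (Suc m)
  then obtain x where x: "x \<in> C" by fastforce
  define B where "B = C - {x}"
  have finB: "finite B" using Suc.prems assms(1) finite_subset unfolding B_def by blast
  have C: "C = insert x B" "x \<notin> B" using x by (auto simp: B_def)
  have B: "B \<subseteq> X" "card B = m" using Suc finB by (auto simp: C)
  have dps: "pair_elems ps \<subseteq> X - C" using pairing_subset Suc.prems by blast
  have const: "alt_sum f ps (insert z B) = alt_sum f ps (insert x B)"
    if z: "z \<in> X - B - pair_elems ps" for z
  proof (cases "z = x")
    case False
    have "pairing (X - B) (ps @ [(x, z)])"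
      using Suc.prems z False dps C by (auto simp: pairing_iff pair_elems_def image_Un)
    then have "alt_sum f (ps @ [(x, z)]) B = 0"
      using Suc B by (intro Suc.hyps(1)) auto
    then show ?thesis by (simp add: alt_sum_append)
  qed simp
  have "pairing (X - B) ps" using Suc.prems C by (auto simp: pairing_iff)
  then have "0 = (\<Sum>z\<in>X - B - pair_elems ps. alt_sum f ps (insert z B))"
    using B Suc by (intro sum_alt_sum_eq_0[OF assms(1,2), symmetric]) auto
  also have "\<dots> = of_nat (card (X - B - pair_elems ps)) * alt_sum f ps C"
    using const by (simp add: C)
  finally have "card (X - B - pair_elems ps) = 0 \<or> alt_sum f ps C = 0" by simp
  moreover have "x \<in> X - B - pair_elems ps" using dps C Suc.prems by auto
  ultimately show ?case using assms(1) by auto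
qed

text \<open>If the element removed by \<open>upper\<close> comes from a pair, the set left over is
  the same for both members, so these terms cancel and only removals from \<open>C\<close> survive.
  For empty \<open>C\<close> nothing survives: polytabloids are orthogonal to the image of
  \<open>upper\<close>.\<close>

lemma alt_sum_upper:
  assumes "finite C" "pairing (X - C) ps" "C \<subseteq> X"
  shows "alt_sum (upper X h) ps C = (\<Sum>y\<in>C. alt_sum h ps (C - {y}))"
  using assms
proof (induction ps arbitrary: C)
  case Nil
  then show ?case by (simp add: upper_def)
next
  case (Cons p ps)
  obtain a b where p: "p = (a, b)" by force
  have *: "alt_sum (upper X h) ps (insert u C) =
      alt_sum h ps C + (\<Sum>y\<in>C. alt_sum h ps (insert u (C - {y})))"
    if "u = a \<or> u = b" for u
  proof -
    have u: "u \<notin> C" "u \<in> X" using that Cons.prems by (auto simp: p)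
    have "pairing (X - insert u C) ps"
      using Cons.prems that by (auto simp: p pairing_iff pair_elems_def)
    then have "alt_sum (upper X h) ps (insert u C) =
       (\<Sum>y\<in>insert u C. alt_sum h ps (insert u C - {y}))"
      using Cons.prems u by (intro Cons.IH) auto
    also have "\<dots> = alt_sum h ps C + (\<Sum>y\<in>C. alt_sum h ps (insert u C - {y}))"
      using Cons.prems u by simp
    also have "(\<Sum>y\<in>C. alt_sum h ps (insert u C - {y})) = (\<Sum>y\<in>C. alt_sum h ps (insert u (C - {y})))"
      using u by (intro sum.cong refl arg_cong[where f = "alt_sum h ps"]) auto
    finally show ?thesis .
  qed
  show ?case by (simp add: p * sum_subtractf)
qed

lemma alt_sum_sum:
  "alt_sum (\<lambda>S. \<Sum>i\<in>I. c i * F i S) ps C = (\<Sum>i\<in>I. c i * alt_sum (F i) ps C)"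
  by (induction ps arbitrary: C) (auto simp: sum_subtractf algebra_simps)

lemma alt_sum_cong:
  assumes "pairing (X - C) ps" "C \<subseteq> X" "finite C"
    and "\<And>S. S \<subseteq> X \<Longrightarrow> card S = card C + length ps \<Longrightarrow> f S = g S"
  shows "alt_sum f ps C = alt_sum g ps C"
  using assms
proof (induction ps arbitrary: C)
  case (Cons p ps)
  obtain a b where p: "p = (a, b)" by force
  have "alt_sum f ps (insert u C) = alt_sum g ps (insert u C)" if "u = a \<or> u = b" for u
    using Cons.prems that by (intro Cons.IH) (auto simp: p pairing_iff pair_elems_def)
  then show ?case by (simp add: p)
qed auto

lemma alt_sum_delta:
  assumes "finite X" "pairing (X - C) ps" "C \<subseteq> X"
  shows "(\<Sum>S\<in>Pow X. f S * alt_sum (\<lambda>T. if T = S then 1 else 0) ps C) = alt_sum f ps C"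
proof -
  have "alt_sum f ps C = alt_sum (\<lambda>T. \<Sum>S\<in>Pow X. f S * (if T = S then 1 else 0)) ps C"
    using assms finite_subset by (intro alt_sum_cong) (auto simp: if_distrib cong: if_cong)
  then show ?thesis by (simp add: alt_sum_sum)
qed

lemma cnj_alt_sum: "cnj (alt_sum f ps C) = alt_sum (\<lambda>S. cnj (f S)) ps C"
  by (induction ps arbitrary: C) auto

section \<open>Commutation and adjointness of the ladder operators\<close>

text \<open>The commutation relation of sl(2). Exchanging an element of \<open>S\<close> for one
  outside contributes equally to both products; what remains are the moves that undo themselves,
  \<open>card X - card S\<close> of them when adding first and \<open>card S\<close> when removing
  first.\<close>

lemma lower_upper:
  assumes "finite X" "S \<subseteq> X"
  shows "lower X (upper X f) S = upper X (lower X f) S + (of_nat (card X) - 2 * of_nat (card S)) * f S"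
proof -
  have fin: "finite S" using assms finite_subset by blast
  have "lower X (upper X f) S = (\<Sum>z\<in>X - S. f S + (\<Sum>y\<in>S. f (insert z S - {y})))"
    unfolding lower_def upper_def using assms fin
    by (auto intro!: sum.cong simp: insert_absorb)
  also have "\<dots> = of_nat (card X - card S) * f S + (\<Sum>z\<in>X - S. \<Sum>y\<in>S. f (insert z S - {y}))"
    using assms fin by (simp add: sum.distrib card_Diff_subset)
  finally have 1: "lower X (upper X f) S =
     of_nat (card X - card S) * f S + (\<Sum>z\<in>X - S. \<Sum>y\<in>S. f (insert z S - {y}))" .
  have "upper X (lower X f) S = (\<Sum>y\<in>S. \<Sum>z\<in>insert y (X - S). f (insert z (S - {y})))"
  proof -
    have "lower X f (S - {y}) = (\<Sum>z\<in>insert y (X - S). f (insert z (S - {y})))" if "y \<in> S" for y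
    proof -
      have "S - {y} \<subseteq> X" "X - (S - {y}) = insert y (X - S)" using that assms by auto
      then show ?thesis by (simp add: lower_def)
    qed
    then show ?thesis using assms by (simp add: upper_def)
  qed
  also have "\<dots> = (\<Sum>y\<in>S. f S + (\<Sum>z\<in>X - S. f (insert z (S - {y}))))"
    using assms by (intro sum.cong refl) (auto simp: insert_absorb)
  also have "\<dots> = (\<Sum>y\<in>S. f S + (\<Sum>z\<in>X - S. f (insert z S - {y})))"
    by (intro sum.cong refl arg_cong2[where f = "(+)"] arg_cong[where f = f]) auto
  also have "\<dots> = of_nat (card S) * f S + (\<Sum>z\<in>X - S. \<Sum>y\<in>S. f (insert z S - {y}))"
    using sum.swap[of "\<lambda>y z. f (insert z S - {y})" "X - S" S] by (simp add: sum.distrib)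
  finally have 2: "upper X (lower X f) S =
     of_nat (card S) * f S + (\<Sum>z\<in>X - S. \<Sum>y\<in>S. f (insert z S - {y}))" .
  have "card S \<le> card X" using assms by (simp add: card_mono)
  then show ?thesis using 1 2 by (simp add: of_nat_diff algebra_simps)
qed

lemma fun_inner_upper:
  assumes "finite X"
  shows "fun_inner X f (upper X g) = fun_inner X (lower X f) g"
proof -
  have "fun_inner X f (upper X g) = (\<Sum>S\<in>Pow X. \<Sum>y\<in>S. f S * cnj (g (S - {y})))"
    by (simp add: fun_inner_def upper_def sum_distrib_left)
  also have "\<dots> = (\<Sum>(S, y)\<in>Sigma (Pow X) (\<lambda>S. S). f S * cnj (g (S - {y})))"
    using assms by (subst sum.Sigma) (auto intro: finite_subset)
  also have "\<dots> = (\<Sum>(T, z)\<in>Sigma (Pow X) (\<lambda>T. X - T). f (insert z T) * cnj (g T))"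
    by (rule sum.reindex_bij_witness[of _ "\<lambda>(T, z). (insert z T, z)" "\<lambda>(S, y). (S - {y}, y)"])
      (auto simp: insert_absorb)
  also have "\<dots> = (\<Sum>T\<in>Pow X. \<Sum>z\<in>X - T. f (insert z T) * cnj (g T))"
    using assms by (subst sum.Sigma) (auto intro: finite_subset)
  also have "\<dots> = fun_inner X (lower X f) g"
    by (simp add: fun_inner_def lower_def sum_distrib_right)
  finally show ?thesis .
qed

section \<open>Polytabloids and homogeneous functions\<close>

definition perm_act :: "('a \<Rightarrow> 'a) \<Rightarrow> ('a set \<Rightarrow> complex) \<Rightarrow> 'a set \<Rightarrow> complex" where
  "perm_act p f S = f (p -` S)"

text \<open>Vanishing off the subsets of \<open>X\<close> is included, so such functions are
  determined by their values on these subsets.\<close>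

definition homogeneous :: "'a set \<Rightarrow> nat \<Rightarrow> ('a set \<Rightarrow> complex) \<Rightarrow> bool" where
  "homogeneous X k f \<longleftrightarrow> (\<forall>S. f S \<noteq> 0 \<longrightarrow> S \<subseteq> X \<and> card S = k)"

definition set_delta :: "'a set \<Rightarrow> 'a set \<Rightarrow> complex" where
  "set_delta S T = (if T = S then 1 else 0)"

text \<open>A subset stands for the second row of a tabloid. The pairs are the columns of length
  two, and moving the second member of a pair into the second row costs a sign.\<close>

definition polytabloid_fun :: "'a set \<Rightarrow> ('a \<times> 'a) list \<Rightarrow> 'a set \<Rightarrow> complex" where
  "polytabloid_fun X ps S = (if S \<subseteq> X then alt_sum (set_delta S) ps {} else 0)"

definition pairings :: "'a set \<Rightarrow> nat \<Rightarrow> ('a \<times> 'a) list set" where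
  "pairings X k = {ps. pairing X ps \<and> length ps = k}"

section \<open>Inner product and orthogonal projection\<close>

lemma fun_inner_cnj: "cnj (fun_inner X f g) = fun_inner X g f"
  by (simp add: fun_inner_def mult.commute)

lemma fun_inner_add_left: "fun_inner X (\<lambda>S. f S + g S) h = fun_inner X f h + fun_inner X g h"
  and fun_inner_add_right: "fun_inner X h (\<lambda>S. f S + g S) = fun_inner X h f + fun_inner X h g"
  and fun_inner_diff_left: "fun_inner X (\<lambda>S. f S - g S) h = fun_inner X f h - fun_inner X g h"
  and fun_inner_scale_left: "fun_inner X (\<lambda>S. c * f S) h = c * fun_inner X f h"
  and fun_inner_scale_right: "fun_inner X h (\<lambda>S. c * f S) = cnj c * fun_inner X h f"
  by (simp_all add: fun_inner_def algebra_simps sum.distrib sum_subtractf sum_distrib_left)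

lemma fun_inner_sum_left: "fun_inner X (\<lambda>S. \<Sum>i\<in>I. c i * F i S) h = (\<Sum>i\<in>I. c i * fun_inner X (F i) h)"
  unfolding fun_inner_def sum_distrib_left sum_distrib_right
  by (subst sum.swap) (simp add: mult.assoc)

lemma fun_inner_sum_right: "fun_inner X h (\<lambda>S. \<Sum>i\<in>I. c i * F i S) = (\<Sum>i\<in>I. cnj (c i) * fun_inner X h (F i))"
proof -
  have "cnj (fun_inner X (\<lambda>S. \<Sum>i\<in>I. c i * F i S) h) = (\<Sum>i\<in>I. cnj (c i) * fun_inner X h (F i))"
    unfolding fun_inner_sum_left by (simp add: fun_inner_cnj)
  then show ?thesis by (simp add: fun_inner_cnj)
qed

lemma fun_inner_zero [simp]: "fun_inner X (\<lambda>_. 0) f = 0" "fun_inner X f (\<lambda>_. 0) = 0"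
  by (simp_all add: fun_inner_def)

lemma fun_inner_self: "fun_inner X f f = of_real (\<Sum>S\<in>Pow X. (cmod (f S))\<^sup>2)"
  by (simp add: fun_inner_def complex_norm_square del: of_real_power)

lemma fun_inner_self_eq_0:
  assumes "finite X"
  shows "fun_inner X f f = 0 \<longleftrightarrow> (\<forall>S\<in>Pow X. f S = 0)"
  using assms by (auto simp: fun_inner_self sum_nonneg_eq_0_iff simp del: of_real_sum)

lemma fun_inner_set_delta:
  assumes "finite X" "S \<subseteq> X"
  shows "fun_inner X f (set_delta S) = f S"
  using assms by (simp add: fun_inner_def set_delta_def if_distrib cong: if_cong)

text \<open>Gram-Schmidt for a family that may be linearly dependent, as polytabloids in general
  are. The induction hypothesis serves twice, for \<open>f\<close> and for the new vector
  \<open>e x\<close>, whose part \<open>w\<close> orthogonal to the old ones provides the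
  correction.\<close>

lemma projection_exists:
  fixes e :: "'i \<Rightarrow> 'a set \<Rightarrow> complex"
  assumes "finite X" "finite I"
  shows "\<exists>c. \<forall>i\<in>I. fun_inner X (\<lambda>S. f S - (\<Sum>j\<in>I. c j * e j S)) (e i) = 0"
  using assms(2)
proof (induction I arbitrary: f)
  case (insert x I)
  obtain c where c: "\<And>i. i \<in> I \<Longrightarrow> fun_inner X (\<lambda>S. f S - (\<Sum>j\<in>I. c j * e j S)) (e i) = 0"
    using insert.IH by blast
  obtain c' where c': "\<And>i. i \<in> I \<Longrightarrow> fun_inner X (\<lambda>S. e x S - (\<Sum>j\<in>I. c' j * e j S)) (e i) = 0"
    using insert.IH by blast
  define g where "g = (\<lambda>S. f S - (\<Sum>j\<in>I. c j * e j S))"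
  define w where "w = (\<lambda>S. e x S - (\<Sum>j\<in>I. c' j * e j S))"
  define a where "a = fun_inner X g w / fun_inner X w w"
  \<comment> \<open>If \<open>w\<close> has norm zero, it vanishes on the subsets of
    \<open>X\<close>, and both sides are zero whatever the quotient is.\<close>
  have a: "fun_inner X g w = a * fun_inner X w w"
  proof (cases "fun_inner X w w = 0")
    case True
    then have "fun_inner X g w = 0"
      using assms(1) by (auto simp: fun_inner_self_eq_0) (auto simp: fun_inner_def)
    then show ?thesis using True by simp
  qed (simp add: a_def)
  define h where "h = (\<lambda>S. g S - a * w S)"
  have h_I: "fun_inner X h (e i) = 0" if "i \<in> I" for i
    using c[OF that] c'[OF that] by (simp add: h_def fun_inner_diff_left fun_inner_scale_left g_def w_def)
  have "fun_inner X h w = 0"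
    using a by (simp add: h_def fun_inner_diff_left fun_inner_scale_left)
  moreover have "fun_inner X h (e x) = fun_inner X h (\<lambda>S. w S + (\<Sum>j\<in>I. c' j * e j S))"
    by (simp add: w_def)
  ultimately have h_x: "fun_inner X h (e x) = 0"
    by (simp add: fun_inner_add_right fun_inner_sum_right h_I)
  define c'' where "c'' = (\<lambda>j. if j = x then a else c j - a * c' j)"
  have "(\<Sum>j\<in>I. c'' j * e j S) = (\<Sum>j\<in>I. c j * e j S - a * (c' j * e j S))" for S
    using insert.hyps by (intro sum.cong) (auto simp: c''_def algebra_simps)
  then have "(\<lambda>S. f S - (\<Sum>j\<in>insert x I. c'' j * e j S)) = h"
    using insert.hyps
    by (auto simp: h_def g_def w_def c''_def sum_subtractf sum_distrib_left algebra_simps)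
  then show ?case
    using h_I h_x by (intro exI[of _ c'']) auto
qed simp

text \<open>Expanding \<open>f\<close> in indicator functions and using linearity of
  \<open>alt_sum\<close> links orthogonality to polytabloids with the alternating sums
  above.\<close>

lemma fun_inner_polytabloid_fun:
  assumes "finite X" "pairing X ps"
  shows "fun_inner X f (polytabloid_fun X ps) = alt_sum f ps {}"
proof -
  have set_delta_eq: "set_delta S = (\<lambda>T. if T = S then 1 else 0)" for S :: "'a set"
    by (auto simp: set_delta_def)
  have cnj_set_delta: "(\<lambda>T. cnj (set_delta S T)) = set_delta S" for S :: "'a set"
    by (auto simp: set_delta_def)
  have "fun_inner X f (polytabloid_fun X ps) = (\<Sum>S\<in>Pow X. f S * alt_sum (set_delta S) ps {})"
    by (simp add: fun_inner_def polytabloid_fun_def cnj_alt_sum cnj_set_delta)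
  also have "\<dots> = alt_sum f ps {}"
    unfolding set_delta_eq using assms by (intro alt_sum_delta) auto
  finally show ?thesis .
qed

lemma fun_inner_upper_polytabloid_fun:
  assumes "finite X" "pairing X ps"
  shows "fun_inner X (upper X f) (polytabloid_fun X ps) = 0"
  using alt_sum_upper[of "{}" X ps f] assms by (simp add: fun_inner_polytabloid_fun)

lemma homogeneous_polytabloid_fun:
  assumes "pairing X ps"
  shows "homogeneous X (length ps) (polytabloid_fun X ps)"
proof -
  have "alt_sum (set_delta S) ps {} = alt_sum (\<lambda>_. 0) ps {}" if "S \<subseteq> X" "card S \<noteq> length ps" for S
    using that assms by (intro alt_sum_cong[where X = X]) (auto simp: set_delta_def)
  moreover have "alt_sum (\<lambda>_. 0) ps C = 0" for C :: "'a set"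
    by (induction ps arbitrary: C) auto
  ultimately show ?thesis by (auto simp: homogeneous_def polytabloid_fun_def split: if_splits)
qed

lemma homogeneous_pairings: "ps \<in> pairings X k \<Longrightarrow> homogeneous X k (polytabloid_fun X ps)"
  using homogeneous_polytabloid_fun[of X ps] by (simp add: pairings_def)

lemma homogeneous_sum:
  assumes "\<And>i. i \<in> I \<Longrightarrow> homogeneous X k (F i)"
  shows "homogeneous X k (\<lambda>S. \<Sum>i\<in>I. c i * F i S)"
  unfolding homogeneous_def
proof (intro allI impI)
  fix S
  assume "(\<Sum>i\<in>I. c i * F i S) \<noteq> 0"
  then obtain i where "i \<in> I" "c i * F i S \<noteq> 0"
    by (rule sum.not_neutral_contains_not_neutral)
  then show "S \<subseteq> X \<and> card S = k"
    using assms by (auto simp: homogeneous_def)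
qed

lemma homogeneous_diff:
  "homogeneous X k f \<Longrightarrow> homogeneous X k g \<Longrightarrow> homogeneous X k (\<lambda>S. f S - g S)"
  unfolding homogeneous_def by (metis diff_zero)

lemma homogeneous_upper:
  assumes "homogeneous X k f" "finite X"
  shows "homogeneous X (Suc k) (upper X f)"
proof -
  have "card S = Suc k" if nz: "upper X f S \<noteq> 0" and S: "S \<subseteq> X" for S
  proof -
    obtain y where y: "y \<in> S" "f (S - {y}) \<noteq> 0"
      using nz S unfolding upper_def by (meson sum.not_neutral_contains_not_neutral)
    then have "card (S - {y}) = k" using assms by (auto simp: homogeneous_def)
    moreover have "finite S" using S assms finite_subset by blast
    ultimately show ?thesis using y by (metis card.remove)
  qed
  then show ?thesis by (auto simp: homogeneous_def upper_def)
qed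

lemma homogeneous_upper_power:
  assumes "homogeneous X k f" "finite X"
  shows "homogeneous X (k + i) ((upper X ^^ i) f)"
  by (induction i) (use assms homogeneous_upper in auto)

lemma homogeneous_set_delta: "S \<subseteq> X \<Longrightarrow> card S = k \<Longrightarrow> homogeneous X k (set_delta S)"
  by (auto simp: homogeneous_def set_delta_def)

lemma upper_sum: "upper X (\<lambda>S. \<Sum>i\<in>I. c i * F i S) = (\<lambda>S. \<Sum>i\<in>I. c i * upper X (F i) S)"
  unfolding upper_def
  by (auto simp: fun_eq_iff sum_distrib_left intro: sum.swap)

lemma upper_add: "upper X (\<lambda>S. f S + g S) = (\<lambda>S. upper X f S + upper X g S)"
  by (auto simp: upper_def fun_eq_iff sum.distrib)

lemma upper_scale: "upper X (\<lambda>S. c * f S) = (\<lambda>S. c * upper X f S)"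
  by (auto simp: upper_def fun_eq_iff sum_distrib_left)

lemma upper_power_add:
  "(upper X ^^ i) (\<lambda>S. f S + g S) = (\<lambda>S. (upper X ^^ i) f S + (upper X ^^ i) g S)"
  by (induction i) (auto simp: upper_add)

lemma upper_power_scale:
  "(upper X ^^ i) (\<lambda>S. c * f S) = (\<lambda>S. c * (upper X ^^ i) f S)"
  by (induction i) (auto simp: upper_scale)

text \<open>Two projections are subtracted: onto the polytabloids, and onto the
  \<open>upper\<close>-images of the indicators of sets of size \<open>k - 1\<close>. The remainder
  is orthogonal to both families. By adjointness the second orthogonality means that
  \<open>lower\<close> annihilates it, so \<open>alt_sum_eq_0_all_lengths\<close> with an empty list
  of pairs makes it zero.\<close>

lemma homogeneous_decomposition:
  assumes "finite X" "homogeneous X k f"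
  obtains c f' where "k = 0 \<longrightarrow> f' = (\<lambda>_. 0)" "homogeneous X (k - 1) f'"
    "f = (\<lambda>S. (\<Sum>ps\<in>pairings X k. c ps * polytabloid_fun X ps S) + upper X f' S)"
proof -
  define J where "J = {S. S \<subseteq> X \<and> Suc (card S) = k}"
  have fin: "finite (pairings X k)" "finite J"
    using assms by (auto simp: pairings_def J_def finite_pairings)
  obtain c where c: "\<And>ps. ps \<in> pairings X k \<Longrightarrow>
      fun_inner X (\<lambda>S. f S - (\<Sum>ps\<in>pairings X k. c ps * polytabloid_fun X ps S)) (polytabloid_fun X ps) = 0"
    using projection_exists[OF assms(1) fin(1), of f "polytabloid_fun X"] by blast
  define h where "h = (\<lambda>S. f S - (\<Sum>ps\<in>pairings X k. c ps * polytabloid_fun X ps S))"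
  obtain b where b: "\<And>T. T \<in> J \<Longrightarrow>
      fun_inner X (\<lambda>S. h S - (\<Sum>T\<in>J. b T * upper X (set_delta T) S)) (upper X (set_delta T)) = 0"
    using projection_exists[OF assms(1) fin(2), of h "\<lambda>T. upper X (set_delta T)"] by blast
  define f' where "f' = (\<lambda>S. \<Sum>T\<in>J. b T * set_delta T S)"
  define h' where "h' = (\<lambda>S. h S - upper X f' S)"
  have f': "homogeneous X (k - 1) f'"
    unfolding f'_def by (intro homogeneous_sum homogeneous_set_delta) (auto simp: J_def)
  have "homogeneous X k (upper X f')"
  \<comment> \<open>The subtraction \<open>k - 1\<close> is truncated; for \<open>k = 0\<close> the
    index set \<open>J\<close> is empty and \<open>f'\<close> is zero.\<close>
  proof (cases k)
    case 0
    then show ?thesis by (auto simp: f'_def J_def upper_def homogeneous_def)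
  next
    case (Suc m)
    then show ?thesis using homogeneous_upper[OF f' assms(1)] by simp
  qed
  moreover have "homogeneous X k h"
    unfolding h_def by (intro homogeneous_diff assms homogeneous_sum homogeneous_pairings)
  ultimately have hom: "homogeneous X k h'"
    unfolding h'_def by (rule homogeneous_diff[rotated])
  have A: "lower X h' S = 0" if "S \<subseteq> X" "Suc (card S) = k" for S
    using b[of S] that fun_inner_upper[OF assms(1), of h' "set_delta S"] assms(1)
    by (simp add: h'_def f'_def upper_sum J_def fun_inner_set_delta)
  \<comment> \<open>The second projection lies in the image of \<open>upper\<close>, so it does not
    disturb the orthogonality achieved by the first.\<close>
  have B: "alt_sum h' ps {} = 0" if "pairing X ps" "length ps = k" for ps
  proof -
    have "fun_inner X h' (polytabloid_fun X ps) = 0"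
      using that c[of ps] assms(1)
      by (simp add: h'_def fun_inner_diff_left fun_inner_upper_polytabloid_fun pairings_def h_def)
    then show ?thesis using that assms(1) by (simp add: fun_inner_polytabloid_fun)
  qed
  have "alt_sum h' [] C = 0" if "C \<subseteq> X" "card C = k" for C
    by (rule alt_sum_eq_0_all_lengths[OF assms(1) A B]) (simp_all add: that)
  then have "h' C = 0" for C
    using hom by (cases "h' C = 0") (auto simp: homogeneous_def)
  then have "f = (\<lambda>S. (\<Sum>ps\<in>pairings X k. c ps * polytabloid_fun X ps S) + upper X f' S)"
    by (simp add: h'_def h_def fun_eq_iff algebra_simps)
  moreover have "k = 0 \<longrightarrow> f' = (\<lambda>_. 0)"
    by (auto simp: f'_def J_def)
  ultimately show ?thesis
    using f' that by blast
qed

section \<open>Orthogonality between Specht modules raised by different powers\<close>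

text \<open>Each commutation of \<open>lower\<close> past an \<open>upper\<close> adds the weight
  \<open>card X - 2 * (k + j)\<close>, and the last term dies with \<open>lower X g\<close>. So
  \<open>c\<close> is the sum of these weights for \<open>j\<close> from 0 to
  \<open>i\<close>.\<close>

lemma lower_upper_power:
  assumes "finite X" "homogeneous X k g" "\<And>S. lower X g S = 0"
  shows "\<exists>c. lower X ((upper X ^^ Suc i) g) = (\<lambda>S. c * (upper X ^^ i) g S)"
proof (induction i)
  case 0
  have "lower X (upper X g) S = (of_nat (card X) - 2 * of_nat k) * g S" for S
  proof (cases "S \<subseteq> X")
    case True
    then show ?thesis
      using lower_upper[OF assms(1) True, of g] assms(2,3)
      by (cases "g S = 0") (auto simp: homogeneous_def upper_def)
  next
    case False
    then show ?thesis using assms(2) by (auto simp: lower_def homogeneous_def)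
  qed
  then show ?case by auto
next
  case (Suc i)
  define h where "h = (upper X ^^ Suc i) g"
  obtain c where c: "lower X h = (\<lambda>S. c * (upper X ^^ i) g S)"
    using Suc by (auto simp: h_def)
  have hom: "homogeneous X (k + Suc i) h"
    unfolding h_def by (rule homogeneous_upper_power) (use assms in auto)
  have "lower X (upper X h) S = (c + of_nat (card X) - 2 * of_nat (k + Suc i)) * h S" for S
  proof (cases "S \<subseteq> X")
    case True
    have "lower X (upper X h) S = c * h S + (of_nat (card X) - 2 * of_nat (card S)) * h S"
      using lower_upper[OF assms(1) True, of h] by (simp add: c upper_scale) (simp add: h_def)
    then show ?thesis using hom
      by (cases "h S = 0") (auto simp: homogeneous_def algebra_simps)
  next
    case False
    then show ?thesis using hom by (auto simp: lower_def homogeneous_def)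
  qed
  then show ?case by (auto simp: h_def)
qed

text \<open>One \<open>upper\<close> on the right moves across as \<open>lower\<close> and takes the
  left argument back to a multiple of the previous power. The claim descends in this way to
  \<open>g\<close> against \<open>upper X f\<close>, where \<open>lower\<close> annihilates
  \<open>g\<close>.\<close>

lemma fun_inner_upper_power_eq_0:
  assumes "finite X" "homogeneous X k g" "\<And>S. lower X g S = 0"
  shows "fun_inner X ((upper X ^^ i) g) ((upper X ^^ Suc i) f) = 0"
proof (induction i)
  case 0
  have "fun_inner X g (upper X f) = fun_inner X (lower X g) f" by (rule fun_inner_upper[OF assms(1)])
  also have "\<dots> = 0" using assms(3) by (simp add: fun_inner_def)
  finally show ?case by simp
next
  case (Suc i)
  obtain c where "lower X ((upper X ^^ Suc i) g) = (\<lambda>S. c * (upper X ^^ i) g S)"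
    using lower_upper_power[OF assms] by blast
  then show ?case
    using Suc fun_inner_upper[OF assms(1), of "(upper X ^^ Suc i) g" "(upper X ^^ Suc i) f"]
    by (simp add: fun_inner_scale_left)
qed

section \<open>Permutations acting on functions of subsets\<close>

lemma vimage_permutes_subset:
  assumes "p permutes X"
  shows "p -` S \<subseteq> X \<longleftrightarrow> S \<subseteq> X"
proof
  assume *: "p -` S \<subseteq> X"
  show "S \<subseteq> X"
  proof
    fix x
    assume "x \<in> S"
    then have "Hilbert_Choice.inv p x \<in> X"
      using * permutes_inverses(1)[OF assms] by (metis subsetD vimageI)
    then show "x \<in> X"
      using permutes_in_image[OF assms, of "Hilbert_Choice.inv p x"] permutes_inverses(1)[OF assms] by simp
  qed
next
  assume "S \<subseteq> X"
  then show "p -` S \<subseteq> X"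
    using permutes_in_image[OF assms] by auto
qed

lemma bij_betw_vimage_Pow:
  assumes "p permutes X"
  shows "bij_betw ((-`) p) (Pow X) (Pow X)"
  by (rule bij_betwI[where g = "(`) p"])
    (use assms in \<open>auto simp: vimage_permutes_subset permutes_image permutes_in_image inj_vimage_image_eq permutes_inj surj_image_vimage_eq permutes_surj\<close>)

lemma fun_inner_perm_act:
  assumes "p permutes X"
  shows "fun_inner X (perm_act p f) (perm_act p g) = fun_inner X f g"
  unfolding fun_inner_def perm_act_def
  using sum.reindex_bij_betw[OF bij_betw_vimage_Pow[OF assms]] .

lemma perm_act_transpose_twice: "perm_act (Transposition.transpose a b) (perm_act (Transposition.transpose a b) f) = f"
  by (auto simp: perm_act_def fun_eq_iff vimage_comp)

lemma fun_inner_perm_act_transpose: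
  assumes "a \<in> X" "b \<in> X"
  shows "fun_inner X (perm_act (Transposition.transpose a b) f) g = fun_inner X f (perm_act (Transposition.transpose a b) g)"
  using fun_inner_perm_act[OF permutes_swap_id[OF assms], of f "perm_act (Transposition.transpose a b) g"]
  by (simp add: perm_act_transpose_twice)

text \<open>\<open>upper\<close> treats all elements of \<open>X\<close> alike. Hence an equivariant
  map stays equivariant after composition with a power of \<open>upper\<close>.\<close>

lemma perm_act_upper:
  assumes "p permutes X"
  shows "perm_act p (upper X f) = upper X (perm_act p f)"
proof
  fix S
  have "(\<Sum>y\<in>p -` S. f (p -` S - {y})) = (\<Sum>y\<in>S. f (p -` (S - {y})))"
    by (rule sum.reindex_bij_witness[of _ "Hilbert_Choice.inv p" p])
      (use assms in \<open>auto simp: permutes_inverses intro!: arg_cong[where f = f] dest: injD[OF permutes_inj]\<close>)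
  then show "perm_act p (upper X f) S = upper X (perm_act p f) S"
    using vimage_permutes_subset[OF assms] by (simp add: perm_act_def upper_def)
qed

lemma perm_act_upper_power:
  assumes "p permutes X"
  shows "perm_act p ((upper X ^^ i) f) = (upper X ^^ i) (perm_act p f)"
  by (induction i) (use assms in \<open>auto simp: perm_act_upper\<close>)

lemma perm_act_add: "perm_act p (\<lambda>S. f S + g S) = (\<lambda>S. perm_act p f S + perm_act p g S)"
  and perm_act_scale: "perm_act p (\<lambda>S. c * f S) = (\<lambda>S. c * perm_act p f S)"
  by (auto simp: perm_act_def)

section \<open>The cone of fidelity vectors\<close>

text \<open>The weight is recorded with the point: weight 1 is membership in \<open>K\<close>, and
  weight 0 admits only the zero vector.\<close>

definition in_cone :: "'v::real_vector set \<Rightarrow> real \<Rightarrow> 'v \<Rightarrow> bool" where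
  "in_cone K t y \<longleftrightarrow> 0 \<le> t \<and> (\<exists>x\<in>K. y = t *\<^sub>R x)"

lemma in_cone_zero: "K \<noteq> {} \<Longrightarrow> in_cone K 0 0"
  by (auto simp: in_cone_def)

lemma in_cone_one: "in_cone K 1 y \<longleftrightarrow> y \<in> K"
  by (auto simp: in_cone_def)

lemma in_cone_add:
  assumes "convex K" "in_cone K s x" "in_cone K t y"
  shows "in_cone K (s + t) (x + y)"
proof -
  obtain u v where uv: "u \<in> K" "v \<in> K" "x = s *\<^sub>R u" "y = t *\<^sub>R v" "0 \<le> s" "0 \<le> t"
    using assms by (auto simp: in_cone_def)
  show ?thesis
  proof (cases "s + t = 0")
    case True
    then have "s = 0" "t = 0" using uv by auto
    then show ?thesis using uv by (auto simp: in_cone_def)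
  next
    case False
    then have "(s / (s + t)) *\<^sub>R u + (t / (s + t)) *\<^sub>R v \<in> K"
      using uv by (intro convexD[OF assms(1)]) (auto simp: add_divide_distrib[symmetric])
    moreover have "x + y = (s + t) *\<^sub>R ((s / (s + t)) *\<^sub>R u + (t / (s + t)) *\<^sub>R v)"
      using False uv by (simp add: scaleR_add_right)
    ultimately show ?thesis using uv unfolding in_cone_def by (intro conjI bexI) auto
  qed
qed

lemma in_cone_sum:
  assumes "convex K" "K \<noteq> {}" "finite I" "\<And>i. i \<in> I \<Longrightarrow> in_cone K (t i) (y i)"
  shows "in_cone K (\<Sum>i\<in>I. t i) (\<Sum>i\<in>I. y i)"
  using assms(3,4) by (induction I) (auto intro: in_cone_add[OF assms(1)] in_cone_zero[OF assms(2)])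

abbreviation sqnorm :: "'a set \<Rightarrow> ('a set \<Rightarrow> complex) \<Rightarrow> real" where
  "sqnorm X f \<equiv> Re (fun_inner X f f)"

text \<open>Kept quadratic, without division by the norm, so that it is additive over a mixture and
  over suitable orthogonal parts. At norm 1 it is the vector of fidelities of the pure state
  \<open>f\<close>.\<close>

definition fidelity_form ::
    "'a set \<Rightarrow> 'a \<Rightarrow> ('N::finite \<Rightarrow> 'a) \<Rightarrow> ('a set \<Rightarrow> complex) \<Rightarrow> real ^ 'N" where
  "fidelity_form X x lbl f =
     (\<chi> a. 1 / 2 * sqnorm X f
        - 1 / 2 * Re (fun_inner X (perm_act (Transposition.transpose x (lbl a)) f) f))"

lemma fidelity_form_zero: "fidelity_form X x lbl (\<lambda>_. 0) = 0"
  by (simp add: fidelity_form_def Finite_Cartesian_Product.vec_eq_iff perm_act_def fun_inner_def)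

lemma sqnorm_add:
  assumes "fun_inner X f g = 0"
  shows "sqnorm X (\<lambda>S. f S + g S) = sqnorm X f + sqnorm X g"
proof -
  have "fun_inner X g f = 0" using fun_inner_cnj[of X f g] assms by simp
  then show ?thesis by (simp add: fun_inner_add_left fun_inner_add_right assms)
qed

text \<open>Orthogonality of \<open>f\<close> and \<open>g\<close> removes the cross terms of the
  norm only. Those of the transpositions are removed by the last assumption, since transpositions
  are self-adjoint.\<close>

lemma fidelity_form_add:
  assumes "x \<in> X" "range lbl \<subseteq> X" "fun_inner X f g = 0"
    "\<And>a. fun_inner X f (perm_act (Transposition.transpose x (lbl a)) g) = 0"
  shows "fidelity_form X x lbl (\<lambda>S. f S + g S) = fidelity_form X x lbl f + fidelity_form X x lbl g"
proof -
  have "fun_inner X (perm_act (Transposition.transpose x (lbl a)) f) g = 0"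
    "fun_inner X (perm_act (Transposition.transpose x (lbl a)) g) f = 0" for a
  proof -
    show "fun_inner X (perm_act (Transposition.transpose x (lbl a)) f) g = 0"
      using assms by (subst fun_inner_perm_act_transpose) auto
    show "fun_inner X (perm_act (Transposition.transpose x (lbl a)) g) f = 0"
      using assms(4)[of a] fun_inner_cnj[of X f] by (metis complex_cnj_zero)
  qed
  then show ?thesis
    using sqnorm_add[OF assms(3)]
    by (simp add: fidelity_form_def Finite_Cartesian_Product.vec_eq_iff perm_act_add fun_inner_add_left fun_inner_add_right algebra_simps
        add_divide_distrib diff_divide_distrib)
qed

text \<open>Induction on the degree with arbitrary \<open>i\<close>: the rest \<open>f'\<close> has
  smaller degree, and the \<open>upper\<close> in front of it is absorbed into the exponent. The
  assumption \<open>irred\<close> isolates what Schur's lemma supplies later.\<close>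

lemma upper_power_in_cone:
  fixes K :: "(real ^ 'N::finite) set"
  assumes "finite X" "x \<in> X" "range lbl \<subseteq> X" "convex K" "K \<noteq> {}"
    and irred: "\<And>k i c. in_cone K
      (sqnorm X ((upper X ^^ i) (\<lambda>S. \<Sum>ps\<in>pairings X k. c ps * polytabloid_fun X ps S)))
      (fidelity_form X x lbl ((upper X ^^ i) (\<lambda>S. \<Sum>ps\<in>pairings X k. c ps * polytabloid_fun X ps S)))"
    and "homogeneous X k f"
  shows "in_cone K (sqnorm X ((upper X ^^ i) f)) (fidelity_form X x lbl ((upper X ^^ i) f))"
  using assms(7)
proof (induction k arbitrary: f i)
  case 0
  obtain c f' where "f' = (\<lambda>_. 0)"
    "f = (\<lambda>S. (\<Sum>ps\<in>pairings X 0. c ps * polytabloid_fun X ps S) + upper X f' S)"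
    using homogeneous_decomposition[OF assms(1) 0] by blast
  moreover have "upper X (\<lambda>_. 0) = (\<lambda>_. 0)" by (simp add: upper_def fun_eq_iff)
  ultimately show ?case using irred by simp
next
  case (Suc k)
  obtain c f' where f': "homogeneous X k f'"
    and f: "f = (\<lambda>S. (\<Sum>ps\<in>pairings X (Suc k). c ps * polytabloid_fun X ps S) + upper X f' S)"
    using homogeneous_decomposition[OF assms(1) Suc.prems, unfolded diff_Suc_1] by blast
  define g where "g = (\<lambda>S. \<Sum>ps\<in>pairings X (Suc k). c ps * polytabloid_fun X ps S)"
  have hom: "homogeneous X (Suc k) g"
    unfolding g_def by (intro homogeneous_sum homogeneous_pairings)
  \<comment> \<open>As a combination of polytabloids, \<open>g\<close> is orthogonal to the image of
    \<open>upper\<close>; adjointness against indicators turns this into a statement about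
    \<open>lower\<close>.\<close>
  have "lower X g S = 0" for S
  proof (cases "S \<subseteq> X")
    case True
    have "fun_inner X g (upper X (set_delta S)) = cnj (fun_inner X (upper X (set_delta S)) g)"
      by (simp add: fun_inner_cnj)
    also have "fun_inner X (upper X (set_delta S)) g = 0"
      using assms(1) by (simp add: g_def fun_inner_sum_right fun_inner_upper_polytabloid_fun pairings_def)
    finally show ?thesis using assms(1) True by (simp add: fun_inner_upper fun_inner_set_delta)
  qed (simp add: lower_def)
  then have orth: "fun_inner X ((upper X ^^ i) g) ((upper X ^^ Suc i) h) = 0" for h
    by (rule fun_inner_upper_power_eq_0[OF assms(1) hom])
  have split: "(upper X ^^ i) f = (\<lambda>S. (upper X ^^ i) g S + (upper X ^^ Suc i) f' S)"
  proof -
    have f_eq: "f = (\<lambda>S. g S + upper X f' S)" using f by (simp add: g_def)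
    show ?thesis unfolding f_eq funpow_Suc_right o_apply by (rule upper_power_add)
  qed
  \<comment> \<open>The permutation passes through the power of \<open>upper\<close>, so
    \<open>orth\<close> applies with the permuted \<open>f'\<close> in the place of
    \<open>h\<close>.\<close>
  have "fun_inner X ((upper X ^^ i) g) (perm_act (Transposition.transpose x (lbl a)) ((upper X ^^ Suc i) f')) = 0" for a
  proof -
    have "Transposition.transpose x (lbl a) permutes X"
      using assms by (intro permutes_swap_id) auto
    then show ?thesis using orth by (simp only: perm_act_upper_power)
  qed
  then have "fidelity_form X x lbl ((upper X ^^ i) f) =
      fidelity_form X x lbl ((upper X ^^ i) g) + fidelity_form X x lbl ((upper X ^^ Suc i) f')"
    unfolding split by (intro fidelity_form_add assms orth)
  moreover have "sqnorm X ((upper X ^^ i) f) = sqnorm X ((upper X ^^ i) g) + sqnorm X ((upper X ^^ Suc i) f')"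
    unfolding split by (rule sqnorm_add[OF orth])
  ultimately show ?case
    using in_cone_add[OF assms(4) irred[where i = i and k = "Suc k" and c = c, folded g_def] Suc.IH[OF f', of "Suc i"]] by simp
qed

lemma card_vimage_permutes:
  assumes "p permutes X"
  shows "card (p -` S) = card S"
  using assms by (intro card_vimage_inj) (auto simp: permutes_inj permutes_surj)

text \<open>Permutations preserve cardinality, so the parts of different degree have no cross terms.
  Cutting \<open>f\<close> down to subsets of \<open>X\<close> loses nothing, because
  \<open>fun_inner\<close> reads only those.\<close>

lemma fidelity_form_in_cone:
  fixes K :: "(real ^ 'N::finite) set"
  assumes "finite X" "x \<in> X" "range lbl \<subseteq> X" "convex K" "K \<noteq> {}"
    and irred: "\<And>k i c. in_cone K
      (sqnorm X ((upper X ^^ i) (\<lambda>S. \<Sum>ps\<in>pairings X k. c ps * polytabloid_fun X ps S)))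
      (fidelity_form X x lbl ((upper X ^^ i) (\<lambda>S. \<Sum>ps\<in>pairings X k. c ps * polytabloid_fun X ps S)))"
  shows "in_cone K (sqnorm X f) (fidelity_form X x lbl f)"
proof -
  define h where "h = (\<lambda>k S. if S \<subseteq> X \<and> card S = k then f S else 0)"
  have "in_cone K (sqnorm X (h k)) (fidelity_form X x lbl (h k))" for k
  proof -
    have "homogeneous X k (h k)" by (simp add: homogeneous_def h_def)
    from upper_power_in_cone[OF assms this, of 0] show ?thesis
      by (simp only: funpow_0)
  qed
  then have "in_cone K (\<Sum>k\<le>card X. sqnorm X (h k)) (\<Sum>k\<le>card X. fidelity_form X x lbl (h k))"
    by (intro in_cone_sum assms(4,5) finite_atMost)
  moreover have *: "(\<Sum>k\<le>card X. fun_inner X (perm_act p (h k)) (h k)) = fun_inner X (perm_act p f) f" if p: "p permutes X" for p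
  proof -
    have "(\<Sum>k\<le>card X. fun_inner X (perm_act p (h k)) (h k))
       = (\<Sum>S\<in>Pow X. \<Sum>k\<le>card X. if card S = k then perm_act p f S * cnj (f S) else 0)"
      unfolding fun_inner_def
      by (subst sum.swap) (use p in \<open>auto intro!: sum.cong simp: h_def perm_act_def vimage_permutes_subset card_vimage_permutes\<close>)
    also have "\<dots> = (\<Sum>S\<in>Pow X. perm_act p f S * cnj (f S))"
      using assms(1) by (intro sum.cong) (auto simp: card_mono)
    finally show ?thesis by (simp add: fun_inner_def)
  qed
  moreover have sq: "(\<Sum>k\<le>card X. sqnorm X (h k)) = sqnorm X f"
    using *[OF permutes_id] by (simp add: perm_act_def[abs_def] flip: Re_sum)
  moreover have "(\<Sum>k\<le>card X. fidelity_form X x lbl (h k)) = fidelity_form X x lbl f"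
  proof -
    have "Transposition.transpose x (lbl a) permutes X" for a
      using assms by (intro permutes_swap_id) auto
    from *[OF this] show ?thesis using sq
      by (simp add: Finite_Cartesian_Product.vec_eq_iff fidelity_form_def sum_subtractf flip: Re_sum sum_divide_distrib sum_distrib_left)
  qed
  ultimately show ?thesis by simp
qed

section \<open>Positive semidefinite kernels\<close>

text \<open>Elimination of one index by a Schur complement: the column of \<open>x\<close> over the
  root of the diagonal entry gives one rank-one term, and what remains on \<open>Y\<close> is again
  positive. Hermiticity of \<open>A\<close> also comes from the hypothesis, which says that the form
  is real.\<close>

lemma psd_sum_of_rank_one:
  fixes A :: "'b \<Rightarrow> 'b \<Rightarrow> complex"
  assumes "finite Y" "\<And>v. 0 \<le> (\<Sum>i\<in>Y. \<Sum>j\<in>Y. cnj (v i) * A i j * v j)"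
  shows "\<exists>(m::nat) w. \<forall>i\<in>Y. \<forall>j\<in>Y. A i j = (\<Sum>l<m. w l i * cnj (w l j))"
  using assms
proof (induction Y arbitrary: A)
  case empty
  then show ?case by auto
next
  case (insert x Y)
  let ?q = "\<lambda>v. \<Sum>i\<in>insert x Y. \<Sum>j\<in>insert x Y. cnj (v i) * A i j * v j"
  have split: "?q v = cnj (v x) * A x x * v x + cnj (v x) * (\<Sum>j\<in>Y. A x j * v j)
      + (\<Sum>i\<in>Y. cnj (v i) * A i x) * v x + (\<Sum>i\<in>Y. \<Sum>j\<in>Y. cnj (v i) * A i j * v j)" for v
    using insert.hyps by (simp add: sum.distrib sum_distrib_left sum_distrib_right algebra_simps)
  \<comment> \<open>Test vectors supported on \<open>x\<close> and \<open>y\<close>. They yield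
    hermiticity and show that a zero diagonal entry forces a zero row.\<close>
  have two: "0 \<le> cnj s * A x x * s + cnj s * (A x y * t) + cnj t * A y x * s + cnj t * A y y * t"
    if y: "y \<in> Y" for y s t
  proof -
    define v where "v = (\<lambda>z. if z = x then s else if z = y then t else 0)"
    have v: "v x = s" "\<And>z. z \<in> Y \<Longrightarrow> v z = (if z = y then t else 0)"
      using insert.hyps by (auto simp: v_def)
    have 1: "(\<Sum>z\<in>Y. F z * v z) = F y * t" for F
    proof -
      have "(\<Sum>z\<in>Y. F z * v z) = (\<Sum>z\<in>Y. if z = y then F y * t else 0)"
        by (intro sum.cong refl) (simp add: v(2))
      then show ?thesis using insert.hyps y by simp
    qed
    have 2: "(\<Sum>z\<in>Y. cnj (v z) * F z) = cnj t * F y" for F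
    proof -
      have "(\<Sum>z\<in>Y. cnj (v z) * F z) = (\<Sum>z\<in>Y. if z = y then cnj t * F y else 0)"
        by (intro sum.cong refl) (simp add: v(2))
      then show ?thesis using insert.hyps y by simp
    qed
    have "?q v = cnj s * A x x * s + cnj s * (A x y * t) + cnj t * A y x * s + cnj t * A y y * t"
      unfolding split v(1) 1 by (simp add: 2 mult.assoc)
    then show ?thesis using insert.prems[of v] by simp
  qed
  have real: "Im (A x x) = 0" "0 \<le> Re (A x x)"
  proof -
    define v where "v = (\<lambda>z. if z = x then 1 else 0 :: complex)"
    have v: "v x = 1" "\<And>z. z \<in> Y \<Longrightarrow> v z = 0"
      using insert.hyps by (auto simp: v_def)
    have "?q v = A x x" unfolding split by (simp add: v cong: sum.cong)
    then have "0 \<le> A x x" using insert.prems[of v] by simp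
    then show "Im (A x x) = 0" "0 \<le> Re (A x x)" by (auto simp: less_eq_complex_def)
  qed
  have Axx: "A x x = of_real (Re (A x x))" using real by (simp add: complex_eq_iff)
  have realy: "Im (A y y) = 0" if "y \<in> Y" for y
    using two[OF that, of 0 1] by (simp add: less_eq_complex_def)
  have herm: "A y x = cnj (A x y)" if y: "y \<in> Y" for y
    using two[OF y, of 1 1] two[OF y, of 1 \<i>] real realy[OF y]
    by (auto simp: less_eq_complex_def complex_eq_iff algebra_simps)
  have zero: "A x y = 0" if y: "y \<in> Y" and A0: "A x x = 0" for y
  proof (rule ccontr)
    assume nz: "A x y \<noteq> 0"
    \<comment> \<open>Chosen so that the form at the vector with entries \<open>s\<close> and 1
      would be -1: the cross terms contribute \<open>- (Re (A y y) + 1)\<close>.\<close>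
    define r where "r = (Re (A y y) + 1) / (2 * (cmod (A x y))\<^sup>2)"
    define s where "s = - of_real r * A x y"
    have "cnj s * A x y = - of_real (r * (cmod (A x y))\<^sup>2)"
      by (simp add: s_def complex_norm_square mult.commute del: of_real_power)
    moreover have "A y x * s = - of_real (r * (cmod (A x y))\<^sup>2)"
      by (simp add: s_def herm[OF y] complex_norm_square mult.commute del: of_real_power)
    ultimately have "0 \<le> Re (A y y) - 2 * (r * (cmod (A x y))\<^sup>2)"
      using two[OF y, of s 1] A0 by (simp add: less_eq_complex_def)
    moreover have "2 * (r * (cmod (A x y))\<^sup>2) = Re (A y y) + 1"
      using nz by (simp add: r_def)
    ultimately show False by simp
  qed
  define a where "a = Re (A x x)"
  define B where "B = (\<lambda>i j. A i j - A i x * A x j / of_real a)"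
  have B_psd: "0 \<le> (\<Sum>i\<in>Y. \<Sum>j\<in>Y. cnj (v i) * B i j * v j)" for v
  proof -
    \<comment> \<open>The entry at \<open>x\<close> that minimises the form for given
      \<open>v\<close> on \<open>Y\<close>; the minimum is the form of \<open>B\<close>. For
      \<open>a = 0\<close> both this quotient and the correction in \<open>B\<close> are
      zero.\<close>
    define s where "s = - (\<Sum>j\<in>Y. A x j * v j) / of_real a"
    define u where "u = v(x := s)"
    have u: "u x = s" "\<And>z. z \<in> Y \<Longrightarrow> u z = v z"
      using insert.hyps by (auto simp: u_def)
    define b where "b = (\<Sum>j\<in>Y. A x j * v j)"
    have b': "(\<Sum>i\<in>Y. cnj (v i) * A i x) = cnj b"
      by (simp add: b_def herm mult.commute cong: sum.cong)
    have "(\<Sum>i\<in>Y. \<Sum>j\<in>Y. cnj (v i) * B i j * v j)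
       = (\<Sum>i\<in>Y. \<Sum>j\<in>Y. cnj (v i) * A i j * v j)
         - (\<Sum>i\<in>Y. \<Sum>j\<in>Y. (cnj (v i) * A i x) * (A x j * v j)) / of_real a"
      by (simp add: B_def algebra_simps sum_subtractf sum_divide_distrib)
    also have "(\<Sum>i\<in>Y. \<Sum>j\<in>Y. (cnj (v i) * A i x) * (A x j * v j)) = cnj b * b"
      by (simp add: sum_product[symmetric] b' b_def[symmetric])
    also have "(\<Sum>i\<in>Y. \<Sum>j\<in>Y. cnj (v i) * A i j * v j) - cnj b * b / of_real a = ?q u"
    proof (cases "a = 0")
      case True
      then show ?thesis
        unfolding split by (simp add: u s_def cong: sum.cong)
    next
      case False
      have "?q u = cnj s * of_real a * s + cnj s * b + cnj b * s
          + (\<Sum>i\<in>Y. \<Sum>j\<in>Y. cnj (v i) * A i j * v j)"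
        unfolding split using Axx by (simp add: u b' b_def[symmetric] a_def[symmetric] cong: sum.cong)
      moreover have "s = - b / of_real a" by (simp add: s_def b_def)
      ultimately show ?thesis using False by simp
    qed
    finally show ?thesis using insert.prems[of u] by simp
  qed
  obtain m :: nat and w where w: "\<And>i j. i \<in> Y \<Longrightarrow> j \<in> Y \<Longrightarrow> B i j = (\<Sum>l<m. w l i * cnj (w l j))"
    using insert.IH[OF B_psd] by blast
  \<comment> \<open>The old vectors are extended by zero at \<open>x\<close>; number
    \<open>m\<close> is the new one, which is zero when \<open>a = 0\<close>.\<close>
  define w' where "w' = (\<lambda>l i. if l < m then if i = x then 0 else w l i else A i x / of_real (sqrt a))"
  have sq: "of_real (sqrt a) * of_real (sqrt a) = (of_real a :: complex)"
    using real by (simp add: a_def flip: of_real_mult)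
  have "A i j = (\<Sum>l<Suc m. w' l i * cnj (w' l j))" if ij: "i \<in> insert x Y" "j \<in> insert x Y" for i j
  proof -
    have herm': "cnj (A k x) = A x k" if "k \<in> insert x Y" for k
      using that herm Axx by (metis complex_cnj_cnj complex_cnj_complex_of_real insertE)
    have "(\<Sum>l<Suc m. w' l i * cnj (w' l j)) =
       (\<Sum>l<m. w' l i * cnj (w' l j)) + A i x * A x j / of_real a"
      using herm'[OF ij(2)] sq by (simp add: w'_def)
    also have "(\<Sum>l<m. w' l i * cnj (w' l j)) = (if i = x \<or> j = x then 0 else B i j)"
      using ij w[of i j] by (auto simp: w'_def)
    also have "\<dots> + A i x * A x j / of_real a = A i j"
    proof (cases "a = 0")
      case True
      then have "A x x = 0" using Axx by (simp add: a_def)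
      then show ?thesis using True zero ij herm by (auto simp: B_def)
    next
      case False
      then show ?thesis using Axx by (auto simp: B_def a_def[symmetric])
    qed
    finally show ?thesis by simp
  qed
  then show ?case by blast
qed

section \<open>Specht modules of two-row partitions\<close>

text \<open>The column group of a tableau whose columns of length two are the pairs and whose other
  columns are single cells.\<close>

definition pair_stabilizer :: "'a set \<Rightarrow> ('a \<times> 'a) list \<Rightarrow> ('a \<Rightarrow> 'a) set" where
  "pair_stabilizer X ps =
     {p. p permutes X \<and> (\<forall>(a, b)\<in>set ps. p ` {a, b} = {a, b}) \<and> (\<forall>x\<in>X - pair_elems ps. p x = x)}"

lemma pair_stabilizer_Nil: "pair_stabilizer X [] = {id}"
  by (auto simp: pair_stabilizer_def permutes_id fun_eq_iff) (metis permutes_not_in)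

lemma pair_stabilizerI:
  assumes "p permutes X" "\<And>a b. (a, b) \<in> set ps \<Longrightarrow> p ` {a, b} = {a, b}"
    "\<And>x. x \<in> X - pair_elems ps \<Longrightarrow> p x = x"
  shows "p \<in> pair_stabilizer X ps"
  using assms unfolding pair_stabilizer_def by blast

lemma pair_stabilizerD: "p \<in> pair_stabilizer X ps \<Longrightarrow> (a, b) \<in> set ps \<Longrightarrow> p ` {a, b} = {a, b}"
  unfolding pair_stabilizer_def by blast

lemma pair_stabilizer_image:
  assumes "p \<in> pair_stabilizer X ps"
  shows "p ` pair_elems ps = pair_elems ps"
proof -
  have pair_elems: "pair_elems ps = (\<Union>x\<in>set ps. {fst x, snd x})"
    by (auto simp: pair_elems_def)
  have "p ` {fst x, snd x} = {fst x, snd x}" if "x \<in> set ps" for x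
    using assms that unfolding pair_stabilizer_def split_beta by blast
  then show ?thesis unfolding pair_elems image_UN by (intro SUP_cong refl)
qed

text \<open>A member that swaps \<open>a\<close> and \<open>b\<close> fixes both after composition
  with their transposition. The resulting two cosets mirror the two terms in the recursion of
  \<open>alt_sum\<close>.\<close>

lemma pair_stabilizer_Cons:
  assumes "pairing X ((a, b) # ps)"
  shows "pair_stabilizer X ((a, b) # ps) =
    pair_stabilizer X ps \<union> (\<circ>) (Transposition.transpose a b) ` pair_stabilizer X ps"
proof -
  let ?t = "Transposition.transpose a b"
  have ab: "a \<in> X" "b \<in> X" "a \<noteq> b" "a \<notin> pair_elems ps" "b \<notin> pair_elems ps"
    using assms pairing_subset[of "X - {a, b}" ps] by auto
  then have t: "?t permutes X" by (intro permutes_swap_id)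
  have fix_pair_elems: "?t x = x" if "x \<in> pair_elems ps" for x
    using that ab by (metis transpose_apply_other)
  have 1: "?t \<circ> p \<in> pair_stabilizer X ps"
    if p: "p \<in> pair_stabilizer X ((a, b) # ps)" "p a \<noteq> a" for p
  proof -
    have img: "p ` {a, b} = {a, b}" and perm: "p permutes X" using p by (auto simp: pair_stabilizer_def)
    then have pab: "p a = b" "p b = a"
      using p(2) ab(3) by (auto simp: doubleton_eq_iff)
    have "(?t \<circ> p) ` {x, y} = {x, y}" if "(x, y) \<in> set ps" for x y
    proof -
      have "p ` {x, y} = {x, y}" using pair_stabilizerD[OF p(1)] that by simp
      moreover have "x \<in> pair_elems ps" "y \<in> pair_elems ps" using that by (force simp: pair_elems_def)+
      ultimately show ?thesis unfolding image_comp[symmetric] by (simp add: fix_pair_elems)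
    qed
    moreover have "(?t \<circ> p) x = x" if "x \<in> X - pair_elems ps" for x
    proof (cases "x = a \<or> x = b")
      case False
      then have "p x = x" using p that by (auto simp: pair_stabilizer_def)
      then show ?thesis using False by (simp add: transpose_apply_other)
    qed (use pab in auto)
    moreover have "?t \<circ> p permutes X" using perm t by (rule permutes_compose)
    ultimately show ?thesis unfolding pair_stabilizer_def by blast
  qed
  have 2: "p \<in> pair_stabilizer X ps" if p: "p \<in> pair_stabilizer X ((a, b) # ps)" "p a = a" for p
  proof -
    have "p ` {a, b} = {a, b}" using p by (auto simp: pair_stabilizer_def)
    then have "p b = b" using p ab(3) by (auto simp: doubleton_eq_iff)
    then show ?thesis using p by (auto simp: pair_stabilizer_def)
  qed
  have 3: "p \<in> pair_stabilizer X ((a, b) # ps)" if "p \<in> pair_stabilizer X ps" for p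
    using that ab by (auto simp: pair_stabilizer_def)
  have 4: "?t \<circ> p \<in> pair_stabilizer X ((a, b) # ps)" if p: "p \<in> pair_stabilizer X ps" for p
  proof -
    have pab: "p a = a" "p b = b" using p ab by (auto simp: pair_stabilizer_def)
    have "(?t \<circ> p) ` {x, y} = {x, y}" if "(x, y) \<in> set ps" for x y
    proof -
      have "p ` {x, y} = {x, y}" by (rule pair_stabilizerD[OF p that])
      moreover have "x \<in> pair_elems ps" "y \<in> pair_elems ps" using that by (force simp: pair_elems_def)+
      ultimately show ?thesis unfolding image_comp[symmetric] by (simp add: fix_pair_elems)
    qed
    moreover have "(?t \<circ> p) ` {a, b} = {a, b}" using pab by auto
    moreover have "(?t \<circ> p) x = x" if "x \<in> X - pair_elems ((a, b) # ps)" for x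
    proof -
      have "p x = x" "x \<noteq> a" "x \<noteq> b" using p that by (auto simp: pair_stabilizer_def)
      then show ?thesis by (simp add: transpose_apply_other)
    qed
    moreover have "p permutes X" using p by (auto simp: pair_stabilizer_def)
    then have "?t \<circ> p permutes X" using t by (rule permutes_compose)
    ultimately show ?thesis by (intro pair_stabilizerI) (auto simp del: image_insert o_apply)
  qed
  show ?thesis
  proof (intro equalityI subsetI)
    fix p
    assume p: "p \<in> pair_stabilizer X ((a, b) # ps)"
    show "p \<in> pair_stabilizer X ps \<union> (\<circ>) ?t ` pair_stabilizer X ps"
    proof (cases "p a = a")
      case False
      have "p = ?t \<circ> (?t \<circ> p)" by (simp add: fun_eq_iff)
      then show ?thesis using 1[OF p False] by blast
    qed (use 2[OF p] in auto)
  qed (use 3 4 in auto)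
qed

lemma finite_pair_stabilizer: "finite X \<Longrightarrow> finite (pair_stabilizer X ps)"
  by (rule finite_subset[OF _ finite_permutations[of X]]) (auto simp: pair_stabilizer_def)

text \<open>The coset of the transposition has the opposite sign and puts \<open>b\<close> instead
  of \<open>a\<close> into the set, as in the recursion of \<open>alt_sum\<close>. The set
  \<open>C\<close> collects the choices already made, so it is arbitrary in the induction.\<close>

lemma sum_pair_stabilizer:
  assumes "finite X" "pairing X ps"
  shows "(\<Sum>p\<in>pair_stabilizer X ps. of_int (sign p) * h (C \<union> p ` fst ` set ps)) = alt_sum h ps C"
  using assms(2)
proof (induction ps arbitrary: C)
  case Nil
  then show ?case by (simp add: pair_stabilizer_Nil sign_id)
next
  case (Cons ab ps)
  obtain a b where p: "ab = (a, b)" by force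
  let ?t = "Transposition.transpose a b"
  let ?P = "pair_stabilizer X ps"
  have ab: "a \<in> X" "b \<in> X" "a \<noteq> b" "a \<notin> pair_elems ps" "b \<notin> pair_elems ps" "pairing X ps"
    using Cons.prems pairing_subset[of "X - {a, b}" ps] by (auto simp: p pairing_iff pair_elems_def)
  have fixp: "q a = a" "q b = b" "permutation q" if "q \<in> ?P" for q
    using that ab assms(1) by (auto simp: pair_stabilizer_def permutation_permutes)
  have img: "q ` fst ` set ps \<subseteq> pair_elems ps" if "q \<in> ?P" for q
  proof -
    have "fst ` set ps \<subseteq> pair_elems ps" by (auto simp: pair_elems_def)
    then show ?thesis using pair_stabilizer_image[OF that] by blast
  qed
  have timg: "(?t \<circ> q) ` fst ` set ps = q ` fst ` set ps" if "q \<in> ?P" for q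
  proof -
    have "?t x = x" if "x \<in> q ` fst ` set ps" for x
      using that img[OF \<open>q \<in> ?P\<close>] ab by (metis subsetD transpose_apply_other)
    then have "?t ` (q ` fst ` set ps) = (\<lambda>x. x) ` (q ` fst ` set ps)"
      by (intro image_cong refl)
    then show ?thesis by (simp only: image_comp[symmetric] image_ident)
  qed
  have disj: "?P \<inter> (\<circ>) ?t ` ?P = {}"
  proof -
    have "(?t \<circ> q) a \<noteq> a" if "q \<in> ?P" for q using fixp[OF that] ab by simp
    then show ?thesis using fixp by fastforce
  qed
  have inj: "inj_on ((\<circ>) ?t) ?P"
    by (rule inj_onI) (metis comp_assoc id_comp transpose_comp_involutory)
  have sgn: "sign (?t \<circ> q) = - sign q" if "q \<in> ?P" for q
    using fixp[OF that] ab by (simp add: sign_compose permutation_swap_id sign_swap_id)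
  have "(\<Sum>q\<in>pair_stabilizer X (ab # ps). of_int (sign q) * h (C \<union> q ` fst ` set (ab # ps)))
     = (\<Sum>q\<in>?P. of_int (sign q) * h (C \<union> q ` fst ` set (ab # ps)))
       + (\<Sum>q\<in>?P. of_int (sign (?t \<circ> q)) * h (C \<union> (?t \<circ> q) ` fst ` set (ab # ps)))"
    unfolding p pair_stabilizer_Cons[OF Cons.prems[unfolded p]]
    using assms(1) disj inj
    by (subst sum.union_disjoint) (auto simp: finite_pair_stabilizer sum.reindex)
  also have "(\<Sum>q\<in>?P. of_int (sign q) * h (C \<union> q ` fst ` set (ab # ps)))
      = (\<Sum>q\<in>?P. of_int (sign q) * h (insert a C \<union> q ` fst ` set ps))"
    by (intro sum.cong) (simp_all add: p fixp)
  also have "(\<Sum>q\<in>?P. of_int (sign (?t \<circ> q)) * h (C \<union> (?t \<circ> q) ` fst ` set (ab # ps)))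
      = (\<Sum>q\<in>?P. - (of_int (sign q) * h (insert b C \<union> q ` fst ` set ps)))"
  proof (intro sum.cong refl)
    fix q
    assume q: "q \<in> ?P"
    have "(?t \<circ> q) ` fst ` set (ab # ps) = insert b ((?t \<circ> q) ` fst ` set ps)"
      using fixp[OF q] by (simp add: p)
    then show "of_int (sign (?t \<circ> q)) * h (C \<union> (?t \<circ> q) ` fst ` set (ab # ps))
       = - (of_int (sign q) * h (insert b C \<union> q ` fst ` set ps))"
      unfolding sgn[OF q] timg[OF q] by simp
  qed
  also have "(\<Sum>q\<in>?P. of_int (sign q) * h (insert a C \<union> q ` fst ` set ps))
     + (\<Sum>q\<in>?P. - (of_int (sign q) * h (insert b C \<union> q ` fst ` set ps)))
     = alt_sum h (ab # ps) C"
    unfolding p alt_sum.simps Cons.IH[OF ab(6), symmetric] by (simp add: sum_negf)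
  finally show ?case .
qed

section \<open>Two-row tableaux and their tabloids\<close>

text \<open>The case distinction avoids a zero part, which \<open>partitions\<close>
  forbids.\<close>

definition two_row :: "nat \<Rightarrow> nat \<Rightarrow> nat list" where
  "two_row n k = (if k = 0 then [n] else [n - k, k])"

text \<open>\<open>S\<close> is the second row; the empty set yields the one-row tabloid, in
  accordance with \<open>two_row n 0\<close>.\<close>

definition set_tabloid :: "nat \<Rightarrow> nat set \<Rightarrow> nat set list" where
  "set_tabloid n S = (if S = {} then [{1..n}] else [{1..n} - S, S])"

text \<open>Entries of the second row come first, because \<open>alt_sum\<close> counts first
  components positively and a tabloid is encoded by its second row. \<open>zip\<close> drops the
  cells of the first row that have nothing below them.\<close>

definition column_pairs :: "nat list list \<Rightarrow> (nat \<times> nat) list" where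
  "column_pairs t = (case t of [r1, r2] \<Rightarrow> zip r2 r1 | _ \<Rightarrow> [])"

lemma two_row_partitions_eq:
  assumes "0 < n"
  shows "two_row_partitions n = two_row n ` {k. 2 * k \<le> n}"
proof (intro equalityI subsetI)
  fix \<mu>
  assume \<mu>: "\<mu> \<in> two_row_partitions n"
  then have len: "length \<mu> \<le> 2" and part: "sorted_wrt (\<ge>) \<mu>" "0 \<notin> set \<mu>" "sum_list \<mu> = n"
    by (auto simp: two_row_partitions_def partitions_def)
  consider "\<mu> = []" | a where "\<mu> = [a]" | a b where "\<mu> = [a, b]"
    using len by (cases \<mu>; cases "tl \<mu>") (auto simp: Suc_le_eq)
  then show "\<mu> \<in> two_row n ` {k. 2 * k \<le> n}"
  proof cases
    case 1
    then show ?thesis using part assms by simp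
  next
    case (2 a)
    then show ?thesis using part by (intro image_eqI[of _ _ 0]) (auto simp: two_row_def)
  next
    case (3 a b)
    then show ?thesis using part by (intro image_eqI[of _ _ b]) (auto simp: two_row_def)
  qed
qed (use assms in \<open>auto simp: two_row_partitions_def partitions_def two_row_def\<close>)

lemma set_tabloid_inject: "set_tabloid n S = set_tabloid n T \<longleftrightarrow> S = T"
  by (auto simp: set_tabloid_def split: if_splits)

lemma tableauE:
  assumes "t \<in> tableaux n (two_row n k)" "2 * k \<le> n"
  obtains r1 r2 where "t = (if k = 0 then [r1] else [r1, r2])" "length r2 = k" "length r1 = n - k"
    "distinct (r1 @ r2)" "set r1 \<union> set r2 = {1..n}"
proof (cases "k = 0")
  case True
  then obtain r1 where "t = [r1]" "length r1 = n"
    using assms by (auto simp: tableaux_def two_row_def)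
  then show ?thesis using assms True that[of r1 "[]"] by (auto simp: tableaux_def)
next
  case False
  then obtain r1 r2 where "t = [r1, r2]" "length r1 = n - k" "length r2 = k"
    using assms by (auto simp: tableaux_def two_row_def)
  then show ?thesis using assms False that[of r1 r2] by (auto simp: tableaux_def)
qed

lemma pair_elems_zip:
  assumes "length r2 \<le> length r1"
  shows "pair_elems (zip r2 r1) = set r2 \<union> set (take (length r2) r1)"
proof -
  have "fst ` set (zip r2 r1) = set r2" "snd ` set (zip r2 r1) = set (take (length r2) r1)"
    using assms by (simp_all flip: list.set_map add: map_fst_zip_take map_snd_zip_take min_absorb1)
  then show ?thesis by (simp add: pair_elems_def)
qed

lemma tableau_column_two_rows:
  assumes "length r2 \<le> length r1" "t = [r1, r2] \<or> r2 = [] \<and> t = [r1]"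
  shows "tableau_column t j =
    (if j < length r2 then {r2 ! j, r1 ! j} else if j < length r1 then {r1 ! j} else {})"
  using assms by (auto simp: tableau_column_def)

text \<open>A column with one cell is preserved as a set exactly when its entry is fixed, which is
  how the condition on columns becomes the two conditions of \<open>pair_stabilizer\<close>.\<close>

lemma column_stabilizer_two_rows:
  assumes "length r2 \<le> length r1" "t = [r1, r2] \<or> r2 = [] \<and> t = [r1]"
    and "distinct (r1 @ r2)" "set r1 \<union> set r2 = {1..n}"
  shows "column_stabilizer n t = pair_stabilizer {1..n} (zip r2 r1)"
proof -
  have rest: "{1..n} - pair_elems (zip r2 r1) = {r1 ! j | j. length r2 \<le> j \<and> j < length r1}"
  proof -
    have "set (take (length r2) r1) \<union> set (drop (length r2) r1) = set r1"
      by (metis append_take_drop_id set_append)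
    moreover have "set (take (length r2) r1) \<inter> set (drop (length r2) r1) = {}"
      using assms(3) set_take_disj_set_drop_if_distinct by fastforce
    ultimately have "{1..n} - pair_elems (zip r2 r1) = set (drop (length r2) r1)"
      unfolding pair_elems_zip[OF assms(1)] assms(4)[symmetric] using assms(3) by auto
    also have "\<dots> = {r1 ! j | j. length r2 \<le> j \<and> j < length r1}"
      unfolding set_conv_nth
    proof (intro equalityI subsetI)
      fix x
      assume "x \<in> {r1 ! j | j. length r2 \<le> j \<and> j < length r1}"
      then obtain j where "x = r1 ! j" "length r2 \<le> j" "j < length r1" by blast
      then show "x \<in> {drop (length r2) r1 ! i | i. i < length (drop (length r2) r1)}"
        by (intro CollectI exI[of _ "j - length r2"]) auto
    qed auto
    finally show ?thesis .
  qed
  have pairs: "set (zip r2 r1) = {(r2 ! j, r1 ! j) | j. j < length r2}"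
    using assms(1) by (auto simp: set_zip)
  \<comment> \<open>Column indices fall into three ranges; past the end of the first row the column
    is empty and the condition is void.\<close>
  have split: "(\<forall>j. P (if j < m then A j else if j < l then B j else {})) \<longleftrightarrow>
      (\<forall>j<m. P (A j)) \<and> (\<forall>j. m \<le> j \<and> j < l \<longrightarrow> P (B j))"
    (is "?L \<longleftrightarrow> ?R") if P: "P {}" for P :: "nat set \<Rightarrow> bool" and m l :: nat and A B
  proof
    assume L: ?L
    have "P (A j)" if "j < m" for j using L[rule_format, of j] that by simp
    moreover have "P (B j)" if "m \<le> j \<and> j < l" for j using L[rule_format, of j] that by simp
    ultimately show ?R by blast
  next
    assume R: ?R
    show ?L
    proof
      fix j
      show "P (if j < m then A j else if j < l then B j else {})"
        using R P by (cases "j < m"; cases "j < l") simp_all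
    qed
  qed
  have "(\<forall>j. p ` tableau_column t j = tableau_column t j) \<longleftrightarrow>
      (\<forall>(a, b)\<in>set (zip r2 r1). p ` {a, b} = {a, b}) \<and> (\<forall>x\<in>{1..n} - pair_elems (zip r2 r1). p x = x)" for p
  proof -
    have "(\<forall>j. p ` tableau_column t j = tableau_column t j) \<longleftrightarrow>
        (\<forall>j<length r2. p ` {r2 ! j, r1 ! j} = {r2 ! j, r1 ! j}) \<and>
        (\<forall>j. length r2 \<le> j \<and> j < length r1 \<longrightarrow> p ` {r1 ! j} = {r1 ! j})"
      unfolding tableau_column_two_rows[OF assms(1,2)] by (rule split) simp
    moreover have "(\<forall>(a, b)\<in>{(r2 ! j, r1 ! j) | j. j < length r2}. Q a b) \<longleftrightarrow>
        (\<forall>j<length r2. Q (r2 ! j) (r1 ! j))" for Q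
      by blast
    moreover have "(\<forall>x\<in>{r1 ! j | j. length r2 \<le> j \<and> j < length r1}. p x = x) \<longleftrightarrow>
        (\<forall>j. length r2 \<le> j \<and> j < length r1 \<longrightarrow> p ` {r1 ! j} = {r1 ! j})"
      by auto
    ultimately show ?thesis unfolding rest pairs by simp
  qed
  then show ?thesis
    by (auto simp: column_stabilizer_def pair_stabilizer_def sym_group_def)
qed

lemma tableau_facts:
  assumes "t \<in> tableaux n (two_row n k)" "2 * k \<le> n"
  shows column_pairs_in_pairings: "column_pairs t \<in> pairings {1..n} k"
    and column_stabilizer_eq: "column_stabilizer n t = pair_stabilizer {1..n} (column_pairs t)"
    and tabloid_map: "p permutes {1..n} \<Longrightarrow>
      tabloid (map (map p) t) = set_tabloid n (p ` fst ` set (column_pairs t))"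
proof -
  obtain r1 r2 where t: "t = (if k = 0 then [r1] else [r1, r2])" and len: "length r2 = k" "length r1 = n - k"
    and dist: "distinct (r1 @ r2)" and sets: "set r1 \<union> set r2 = {1..n}"
    using tableauE[OF assms] by metis
  have le: "length r2 \<le> length r1" using assms(2) len by simp
  have pairs: "column_pairs t = zip r2 r1" using len by (auto simp: column_pairs_def t)
  have fst: "fst ` set (zip r2 r1) = set r2"
    using le by (simp flip: list.set_map add: map_fst_zip_take min_absorb1)
  have "map snd (zip r2 r1) = take (length r2) r1" "map fst (zip r2 r1) = r2"
    using le by (simp_all add: map_fst_zip_take map_snd_zip_take min_absorb1)
  then have "distinct (map fst (zip r2 r1) @ map snd (zip r2 r1))"
    using dist by (auto dest: in_set_takeD)
  moreover have "pair_elems (zip r2 r1) \<subseteq> {1..n}"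
    unfolding pair_elems_zip[OF le] sets[symmetric] by (auto dest: in_set_takeD)
  ultimately show "column_pairs t \<in> pairings {1..n} k"
    using le len by (simp add: pairings_def pairing_iff pairs)
  show "column_stabilizer n t = pair_stabilizer {1..n} (column_pairs t)"
    unfolding pairs using t len by (intro column_stabilizer_two_rows le dist sets) auto
  assume p: "p permutes {1..n}"
  have "set r1 = {1..n} - set r2" using dist sets by auto
  then have "p ` set r1 = {1..n} - p ` set r2"
    using permutes_image[OF p] permutes_inj[OF p] by (simp add: image_set_diff)
  then show "tabloid (map (map p) t) = set_tabloid n (p ` fst ` set (column_pairs t))"
    unfolding pairs fst using t len by (auto simp: tabloid_def set_tabloid_def)
qed

text \<open>This is \<open>sum_pair_stabilizer\<close> with empty \<open>C\<close>, read through the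
  encoding of tabloids by their second rows.\<close>

lemma polytabloid_set_tabloid:
  assumes "t \<in> tableaux n (two_row n k)" "2 * k \<le> n" "S \<subseteq> {1..n}"
  shows "polytabloid n t (set_tabloid n S) = polytabloid_fun {1..n} (column_pairs t) S"
proof -
  note facts = tableau_facts[OF assms(1,2)]
  let ?ps = "column_pairs t"
  have "polytabloid n t (set_tabloid n S) =
      (\<Sum>p\<in>pair_stabilizer {1..n} ?ps. of_int (sign p) * set_delta S ({} \<union> p ` fst ` set ?ps))"
    unfolding polytabloid_def facts(2)
    by (intro sum.cong refl) (auto simp: facts(3) set_tabloid_inject set_delta_def pair_stabilizer_def)
  also have "\<dots> = alt_sum (set_delta S) ?ps {}"
    by (rule sum_pair_stabilizer) (use facts(1) in \<open>auto simp: pairings_def\<close>)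
  finally show ?thesis using assms(3) by (simp add: polytabloid_fun_def)
qed

lemma polytabloid_support:
  assumes "t \<in> tableaux n (two_row n k)" "2 * k \<le> n" "polytabloid n t T \<noteq> 0"
  shows "\<exists>S \<subseteq> {1..n}. T = set_tabloid n S"
proof -
  note facts = tableau_facts[OF assms(1,2)]
  obtain p where "p \<in> column_stabilizer n t"
    "of_int (sign p) * (if T = tabloid (map (map p) t) then 1 else 0) \<noteq> (0 :: complex)"
    using assms(3) unfolding polytabloid_def by (rule sum.not_neutral_contains_not_neutral)
  then have p: "p \<in> column_stabilizer n t" "T = tabloid (map (map p) t)"
    by (auto split: if_splits)
  then have perm: "p permutes {1..n}" by (auto simp: column_stabilizer_def sym_group_def)
  have "fst ` set (column_pairs t) \<subseteq> {1..n}"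
    using facts(1) pairing_subset[of "{1..n}" "column_pairs t"] by (auto simp: pairings_def pair_elems_def)
  then have "p ` fst ` set (column_pairs t) \<subseteq> {1..n}"
    using permutes_image[OF perm] by blast
  then show ?thesis using facts(3)[OF perm] p(2) by blast
qed

lemma ex_tableau_column_pairs:
  assumes "ps \<in> pairings {1..n} k" "2 * k \<le> n"
  shows "\<exists>t\<in>tableaux n (two_row n k). column_pairs t = ps"
proof (cases "k = 0")
  case True
  then have "[[1..<Suc n]] \<in> tableaux n (two_row n k)" "ps = []"
    using assms by (auto simp: tableaux_def two_row_def pairings_def)
  then show ?thesis by (auto simp: column_pairs_def intro!: bexI[of _ "[[1..<Suc n]]"])
next
  case False
  define rest where "rest = sorted_list_of_set ({1..n} - pair_elems ps)"
  have ps: "distinct (map fst ps @ map snd ps)" "pair_elems ps \<subseteq> {1..n}" "length ps = k"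
    using assms by (auto simp: pairings_def pairing_iff)
  have "card (pair_elems ps) = 2 * k" using assms(1) by (auto simp: pairings_def card_pair_elems)
  then have len: "length rest = n - 2 * k"
    using ps(2) by (simp add: rest_def card_Diff_subset)
  have rest: "set rest = {1..n} - pair_elems ps" "distinct rest" by (auto simp: rest_def)
  let ?t = "[map snd ps @ rest, map fst ps]"
  have "set (concat ?t) = {1..n}"
    using ps(2) rest by (auto simp: pair_elems_def)
  moreover have "distinct (concat ?t)"
    using ps(1) rest by (auto simp: pair_elems_def)
  ultimately have "?t \<in> tableaux n (two_row n k)"
    using False ps(3) len assms(2) by (auto simp: tableaux_def two_row_def)
  moreover have "column_pairs ?t = ps"
    by (simp add: column_pairs_def zip_append2 zip_map_fst_snd)
  ultimately show ?thesis by blast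
qed

lemma finite_tableaux: "finite (tableaux n \<mu>)"
proof (rule finite_subset)
  show "tableaux n \<mu> \<subseteq> {t. set t \<subseteq> {r. set r \<subseteq> {1..n} \<and> length r \<le> sum_list \<mu>} \<and> length t = length \<mu>}"
  proof
    fix t
    assume "t \<in> tableaux n \<mu>"
    then have t: "map length t = \<mu>" "set (concat t) = {1..n}" by (auto simp: tableaux_def)
    have "set r \<subseteq> {1..n} \<and> length r \<le> sum_list \<mu>" if "r \<in> set t" for r
      using that t by (auto intro: member_le_sum_list)
    then show "t \<in> {t. set t \<subseteq> {r. set r \<subseteq> {1..n} \<and> length r \<le> sum_list \<mu>} \<and> length t = length \<mu>}"
      using t by auto
  qed
  show "finite {t. set t \<subseteq> {r. set r \<subseteq> {1..n} \<and> length r \<le> sum_list \<mu>} \<and> length t = length \<mu>}"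
    by (intro finite_lists_length_eq finite_lists_length_le) auto
qed

section \<open>Transport of Specht modules to functions of subsets\<close>

definition subset_fun :: "nat \<Rightarrow> (nat set list \<Rightarrow> complex) \<Rightarrow> nat set \<Rightarrow> complex" where
  "subset_fun n F S = (if S \<subseteq> {1..n} then F (set_tabloid n S) else 0)"

lemma subset_fun_specht:
  assumes "2 * k \<le> n" "F = (\<lambda>T. \<Sum>t\<in>tableaux n (two_row n k). c t * polytabloid n t T)"
  shows "subset_fun n F =
    (\<lambda>S. \<Sum>t\<in>tableaux n (two_row n k). c t * polytabloid_fun {1..n} (column_pairs t) S)"
proof
  fix S
  show "subset_fun n F S = (\<Sum>t\<in>tableaux n (two_row n k). c t * polytabloid_fun {1..n} (column_pairs t) S)"
  proof (cases "S \<subseteq> {1..n}")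
    case True
    then show ?thesis
      unfolding assms(2) subset_fun_def using assms(1)
      by (auto intro!: sum.cong simp: polytabloid_set_tabloid)
  next
    case False
    then show ?thesis by (simp add: subset_fun_def polytabloid_fun_def)
  qed
qed

lemma homogeneous_subset_fun:
  assumes "2 * k \<le> n" "F \<in> specht n (two_row n k)"
  shows "homogeneous {1..n} k (subset_fun n F)"
proof -
  obtain c where F: "F = (\<lambda>T. \<Sum>t\<in>tableaux n (two_row n k). c t * polytabloid n t T)"
    using assms(2) by (auto simp: specht_def)
  show ?thesis
    unfolding subset_fun_specht[OF assms(1) F]
  proof (rule homogeneous_sum)
    fix t
    assume "t \<in> tableaux n (two_row n k)"
    then have "column_pairs t \<in> pairings {1..n} k"
      using column_pairs_in_pairings assms(1) by blast
    then show "homogeneous {1..n} k (polytabloid_fun {1..n} (column_pairs t))"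
      by (rule homogeneous_pairings)
  qed
qed

text \<open>Injectivity of \<open>subset_fun\<close> on the Specht module: polytabloids are
  supported on tabloids that come from subsets, so no information is lost.\<close>

lemma subset_fun_eq_0:
  assumes "2 * k \<le> n" "F \<in> specht n (two_row n k)" "\<And>S. S \<subseteq> {1..n} \<Longrightarrow> subset_fun n F S = 0"
  shows "F = (\<lambda>_. 0)"
proof
  fix T
  obtain c where F: "F = (\<lambda>T. \<Sum>t\<in>tableaux n (two_row n k). c t * polytabloid n t T)"
    using assms(2) by (auto simp: specht_def)
  show "F T = 0"
  proof (rule ccontr)
    assume nz: "F T \<noteq> 0"
    then obtain t where "t \<in> tableaux n (two_row n k)" "c t * polytabloid n t T \<noteq> 0"
      unfolding F by (rule sum.not_neutral_contains_not_neutral)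
    then have "t \<in> tableaux n (two_row n k)" "polytabloid n t T \<noteq> 0" by auto
    then have "\<exists>S \<subseteq> {1..n}. T = set_tabloid n S"
      using polytabloid_support[OF _ assms(1)] by blast
    then obtain S where "S \<subseteq> {1..n}" "T = set_tabloid n S" by blast
    then show False using assms(3)[of S] nz by (simp add: subset_fun_def)
  qed
qed

text \<open>Tableaux that differ only in the order of their single cells have the same column pairs.
  So one tableau is selected for each list of pairs, and all others get coefficient zero.\<close>

lemma ex_specht_subset_fun:
  assumes "2 * k \<le> n"
  shows "\<exists>F\<in>specht n (two_row n k).
    subset_fun n F = (\<lambda>S. \<Sum>ps\<in>pairings {1..n} k. c ps * polytabloid_fun {1..n} ps S)"
proof -
  let ?P = "pairings {1..n} k" and ?T = "tableaux n (two_row n k)"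
  obtain tab where tab: "\<And>ps. ps \<in> ?P \<Longrightarrow> tab ps \<in> ?T \<and> column_pairs (tab ps) = ps"
    using ex_tableau_column_pairs[OF _ assms] by metis
  define c' where "c' = (\<lambda>t. if t \<in> tab ` ?P then c (column_pairs t) else 0)"
  define F where "F = (\<lambda>T. \<Sum>t\<in>?T. c' t * polytabloid n t T)"
  have inj: "inj_on tab ?P" by (rule inj_onI) (metis tab)
  have "subset_fun n F S = (\<Sum>ps\<in>?P. c ps * polytabloid_fun {1..n} ps S)" for S
  proof -
    have "subset_fun n F S = (\<Sum>t\<in>?T. c' t * polytabloid_fun {1..n} (column_pairs t) S)"
      using subset_fun_specht[OF assms F_def] by simp
    also have "\<dots> = (\<Sum>t\<in>tab ` ?P. c' t * polytabloid_fun {1..n} (column_pairs t) S)"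
      using tab by (intro sum.mono_neutral_right finite_tableaux) (auto simp: c'_def)
    also have "\<dots> = (\<Sum>ps\<in>?P. c ps * polytabloid_fun {1..n} ps S)"
      unfolding sum.reindex[OF inj] by (intro sum.cong) (auto simp: c'_def tab)
    finally show ?thesis .
  qed
  moreover have "F \<in> specht n (two_row n k)" by (auto simp: specht_def F_def)
  ultimately show ?thesis by blast
qed

lemma subset_fun_tabloid_action:
  assumes "p permutes {1..n}"
  shows "subset_fun n (tabloid_action p F) = perm_act p (subset_fun n F)"
proof
  fix S
  have "map ((-`) p) (set_tabloid n S) = set_tabloid n (p -` S)"
  proof -
    have "p -` S = {} \<longleftrightarrow> S = {}"
      using permutes_surj[OF assms] by (metis image_empty surj_image_vimage_eq vimage_empty)
    then show ?thesis
      using permutes_vimage[OF assms] by (simp add: set_tabloid_def vimage_Diff)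
  qed
  then show "subset_fun n (tabloid_action p F) S = perm_act p (subset_fun n F) S"
    using vimage_permutes_subset[OF assms] by (simp add: subset_fun_def tabloid_action_def perm_act_def)
qed

section \<open>Intertwiners\<close>

lemma mat_adjoint_carrier: "A \<in> carrier_mat d d \<Longrightarrow> mat_adjoint A \<in> carrier_mat d d"
  by (auto simp: mat_adjoint_def mat_of_rows_def)

lemma mat_adjoint_index:
  assumes "(A :: complex mat) \<in> carrier_mat d d" "i < d" "j < d"
  shows "mat_adjoint A $$ (i, j) = cnj (A $$ (j, i))"
  using assms by (simp add: mat_adjoint_def mat_of_rows_def)

lemma inner_mat_adjoint:
  fixes A :: "complex mat"
  assumes "A \<in> carrier_mat d d" "v \<in> carrier_vec d" "w \<in> carrier_vec d"
  shows "(A *\<^sub>v v) \<bullet>c w = v \<bullet>c (mat_adjoint A *\<^sub>v w)"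
proof -
  have "(A *\<^sub>v v) \<bullet>c w = (\<Sum>i\<in>{0..<d}. \<Sum>j\<in>{0..<d}. A $$ (i, j) * v $ j * cnj (w $ i))"
    using assms by (simp add: scalar_prod_def sum_distrib_right)
  also have "\<dots> = (\<Sum>j\<in>{0..<d}. \<Sum>i\<in>{0..<d}. A $$ (i, j) * v $ j * cnj (w $ i))"
    by (rule sum.swap)
  also have "\<dots> = v \<bullet>c (mat_adjoint A *\<^sub>v w)"
    using assms mat_adjoint_carrier[OF assms(1)]
    by (simp add: scalar_prod_def sum_distrib_left mat_adjoint_index mult_ac)
  finally show ?thesis .
qed

lemma cscalar_prod_unit_vec:
  assumes "(v :: complex vec) \<in> carrier_vec d" "i < d"
  shows "v \<bullet>c unit_vec d i = v $ i"
proof -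
  have "v \<bullet>c unit_vec d i = (\<Sum>j\<in>{0..<d}. if j = i then v $ j else 0)"
    unfolding scalar_prod_def using assms by (intro sum.cong) (auto simp: unit_vec_def)
  then show ?thesis using assms by simp
qed

lemma vec_eq_if_cscalar_prod_eq:
  assumes "(v :: complex vec) \<in> carrier_vec d" "w \<in> carrier_vec d"
    "\<And>x. x \<in> carrier_vec d \<Longrightarrow> v \<bullet>c x = w \<bullet>c x"
  shows "v = w"
proof (rule eq_vecI)
  fix i
  assume "i < dim_vec w"
  then show "v $ i = w $ i"
    using assms(3)[of "unit_vec d i"] assms(1,2) cscalar_prod_unit_vec[of _ d i] by auto
qed (use assms in auto)

text \<open>Neither injectivity nor homogeneity is built in, so the composition with a power of
  \<open>upper\<close>, possibly zero, is again an intertwiner.\<close>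

definition intertwiner ::
    "nat \<Rightarrow> nat \<Rightarrow> ((nat \<Rightarrow> nat) \<Rightarrow> complex mat) \<Rightarrow> (complex vec \<Rightarrow> nat set \<Rightarrow> complex) \<Rightarrow> bool" where
  "intertwiner n d V T \<longleftrightarrow>
     (\<forall>v\<in>carrier_vec d. \<forall>w\<in>carrier_vec d. T (v + w) = (\<lambda>S. T v S + T w S)) \<and>
     (\<forall>c. \<forall>v\<in>carrier_vec d. T (c \<cdot>\<^sub>v v) = (\<lambda>S. c * T v S)) \<and>
     (\<forall>p. p permutes {1..n} \<longrightarrow> (\<forall>v\<in>carrier_vec d. T (V p *\<^sub>v v) = perm_act p (T v)))"

lemma intertwinerD:
  assumes "intertwiner n d V T" "v \<in> carrier_vec d"
  shows "w \<in> carrier_vec d \<Longrightarrow> T (v + w) = (\<lambda>S. T v S + T w S)"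
    and "T (c \<cdot>\<^sub>v v) = (\<lambda>S. c * T v S)"
    and "p permutes {1..n} \<Longrightarrow> T (V p *\<^sub>v v) = perm_act p (T v)"
  using assms by (auto simp: intertwiner_def)

lemma intertwiner_expand:
  assumes T: "intertwiner n d V T" and v: "v \<in> carrier_vec d"
  shows "T v = (\<lambda>S. \<Sum>j\<in>{0..<d}. v $ j * T (unit_vec d j) S)"
proof -
  have "T (vec d (\<lambda>i. if i < m then v $ i else 0)) = (\<lambda>S. \<Sum>j\<in>{0..<m}. v $ j * T (unit_vec d j) S)"
    if "m \<le> d" for m
    using that
  proof (induction m)
    case 0
    have "vec d (\<lambda>i. if i < (0::nat) then v $ i else 0) = 0 \<cdot>\<^sub>v 0\<^sub>v d" by (intro eq_vecI) auto
    then show ?case using intertwinerD(2)[OF T, of "0\<^sub>v d" 0] by simp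
  next
    case (Suc m)
    have "vec d (\<lambda>i. if i < Suc m then v $ i else 0) =
        vec d (\<lambda>i. if i < m then v $ i else 0) + v $ m \<cdot>\<^sub>v unit_vec d m"
      by (intro eq_vecI) (auto simp: less_Suc_eq unit_vec_def)
    then show ?case using Suc by (simp add: intertwinerD(1,2)[OF T])
  qed
  from this[of d] have "T (vec d (\<lambda>i. if i < d then v $ i else 0)) =
      (\<lambda>S. \<Sum>j\<in>{0..<d}. v $ j * T (unit_vec d j) S)" by simp
  moreover have "vec d (\<lambda>i. if i < d then v $ i else 0) = v"
    using v by (intro eq_vecI) auto
  ultimately show ?thesis by simp
qed

lemma unitary_mat_mult_adjoint:
  assumes "unitary_mat d U"
  shows "U \<in> carrier_mat d d" "U * mat_adjoint U = 1\<^sub>m d"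
  using assms mat_adjoint_carrier[of U d] mat_mult_left_right_inverse[of "mat_adjoint U" d U]
  by (auto simp: unitary_mat_def)

text \<open>
  Schur's lemma: the inner product pulled back along an intertwiner is given by a matrix that
  commutes with the representation, and each of its eigenspaces is invariant.
\<close>

lemma schur_inner_product:
  assumes rep: "unitary_rep n d V" and irr: "irreducible_rep n d V" and T: "intertwiner n d V T"
  shows "\<exists>c\<ge>0. \<forall>v\<in>carrier_vec d. \<forall>w\<in>carrier_vec d.
    fun_inner {1..n} (T v) (T w) = of_real c * (v \<bullet>c w)"
proof -
  let ?X = "{1..n}"
  have d: "0 < d" using irr by (simp add: irreducible_rep_def)
  \<comment> \<open>The Gram matrix of the pulled back form, with swapped indices because the second
    argument is the conjugated one.\<close>
  define G where "G = mat d d (\<lambda>(i, j). fun_inner ?X (T (unit_vec d j)) (T (unit_vec d i)))"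
  have G: "G \<in> carrier_mat d d" by (simp add: G_def)
  have fun_inner_G: "fun_inner ?X (T v) (T w) = (G *\<^sub>v v) \<bullet>c w" if "v \<in> carrier_vec d" "w \<in> carrier_vec d" for v w
  proof -
    have "fun_inner ?X (T v) (T w) = (\<Sum>j\<in>{0..<d}. v $ j * (\<Sum>i\<in>{0..<d}. cnj (w $ i) *
        fun_inner ?X (T (unit_vec d j)) (T (unit_vec d i))))"
      by (subst intertwiner_expand[OF T that(1)], subst intertwiner_expand[OF T that(2)])
        (simp only: fun_inner_sum_left fun_inner_sum_right)
    also have "\<dots> = (\<Sum>j\<in>{0..<d}. \<Sum>i\<in>{0..<d}. G $$ (i, j) * v $ j * cnj (w $ i))"
      by (simp add: G_def sum_distrib_left mult_ac)
    also have "\<dots> = (\<Sum>i\<in>{0..<d}. \<Sum>j\<in>{0..<d}. G $$ (i, j) * v $ j * cnj (w $ i))"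
      by (rule sum.swap)
    also have "\<dots> = (G *\<^sub>v v) \<bullet>c w"
      using that G by (simp add: scalar_prod_def sum_distrib_right)
    finally show ?thesis .
  qed
  have commute: "G *\<^sub>v (V p *\<^sub>v v) = V p *\<^sub>v (G *\<^sub>v v)"
    if p: "p \<in> carrier (sym_group n)" and v: "v \<in> carrier_vec d" for p v
  proof -
    have perm: "p permutes ?X" using p by (simp add: sym_group_def)
    have "unitary_mat d (V p)" using rep p by (auto simp: unitary_rep_def)
    note U = unitary_mat_mult_adjoint[OF this]
    note U' = mat_adjoint_carrier[OF U(1)]
    show ?thesis
    proof (rule vec_eq_if_cscalar_prod_eq)
      fix w :: "complex vec"
      assume w: "w \<in> carrier_vec d"
      \<comment> \<open>By unitarity every test vector is \<open>V p\<close> applied to some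
        \<open>w'\<close>; invariance of \<open>fun_inner\<close> under permutations then removes
        \<open>p\<close> from both arguments.\<close>
      define w' where "w' = mat_adjoint (V p) *\<^sub>v w"
      have w': "w' \<in> carrier_vec d" using U' w by (auto simp: w'_def)
      have "V p *\<^sub>v w' = (V p * mat_adjoint (V p)) *\<^sub>v w"
        unfolding w'_def using U(1) U' w by (simp add: assoc_mult_mat_vec)
      then have "w = V p *\<^sub>v w'" using U(2) w by simp
      then have "(G *\<^sub>v (V p *\<^sub>v v)) \<bullet>c w = fun_inner ?X (T (V p *\<^sub>v v)) (T (V p *\<^sub>v w'))"
        using fun_inner_G[of "V p *\<^sub>v v" w] U(1) v w by simp
      also have "\<dots> = fun_inner ?X (T v) (T w')"
        using intertwinerD(3)[OF T _ perm] v w' fun_inner_perm_act[OF perm] by simp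
      also have "\<dots> = (V p *\<^sub>v (G *\<^sub>v v)) \<bullet>c w"
        using fun_inner_G[OF v w'] inner_mat_adjoint[OF U(1) _ w, of "G *\<^sub>v v"] G v by (simp add: w'_def)
      finally show "(G *\<^sub>v (V p *\<^sub>v v)) \<bullet>c w = (V p *\<^sub>v (G *\<^sub>v v)) \<bullet>c w" .
    qed (use G U v in auto)
  qed
  obtain k where "eigenvalue G k"
    using spectrum_non_empty[OF G d] by (auto simp: spectrum_def)
  then obtain v0 where v0: "v0 \<in> carrier_vec d" "v0 \<noteq> 0\<^sub>v d" "G *\<^sub>v v0 = k \<cdot>\<^sub>v v0"
    using G by (auto simp: eigenvalue_def eigenvector_def)
  define W where "W = {v \<in> carrier_vec d. G *\<^sub>v v = k \<cdot>\<^sub>v v}"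
  have "VectorSpace.subspace class_ring W (module_vec TYPE(complex) d)"
    unfolding VectorSpace.subspace_def LinearCombinations.submodule_def
    using vec_vs vec_module G
    by (auto simp: module_vec_simps W_def mult_add_distrib_mat_vec smult_add_distrib_vec
        mult_mat_vec smult_smult_assoc mult.commute)
  moreover have "V p *\<^sub>v w \<in> W" if "p \<in> carrier (sym_group n)" "w \<in> W" for p w
  proof -
    have "unitary_mat d (V p)" using rep that by (auto simp: unitary_rep_def)
    note U = unitary_mat_mult_adjoint[OF this]
    show ?thesis
      using that U(1) commute[of p w] by (auto simp: W_def mult_mat_vec)
  qed
  ultimately have "W = {0\<^sub>v d} \<or> W = carrier_vec d"
    using irr by (auto simp: irreducible_rep_def)
  then have W: "W = carrier_vec d" using v0 by (auto simp: W_def)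
  have scalar: "fun_inner ?X (T v) (T w) = k * (v \<bullet>c w)" if "v \<in> carrier_vec d" "w \<in> carrier_vec d" for v w
  proof -
    have "G *\<^sub>v v = k \<cdot>\<^sub>v v" using W that(1) by (auto simp: W_def)
    then show ?thesis using fun_inner_G[OF that] that by simp
  qed
  \<comment> \<open>At a unit vector the eigenvalue is seen to be a squared norm, hence real and
    nonnegative; zero remains possible.\<close>
  have "k = fun_inner ?X (T (unit_vec d 0)) (T (unit_vec d 0))"
    using scalar[of "unit_vec d 0" "unit_vec d 0"] cscalar_prod_unit_vec[of "unit_vec d 0" d 0] d
    by simp
  then obtain c where "k = of_real c" "0 \<le> c"
    by (simp add: fun_inner_self sum_nonneg del: of_real_sum)
  then show ?thesis using scalar by blast
qed

text \<open>The label enters the proof through these properties. Homogeneity and injectivity turn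
  unit vectors of the representation into states of fixed weight; reaching every combination of
  polytabloids feeds the decomposition. Nothing is claimed about inner products: that is left to
  Schur's lemma.\<close>

lemma irrep_labelled_by_intertwiner:
  assumes "2 * k \<le> n" "irrep_labelled_by n (two_row n k) d V"
  shows "\<exists>T. intertwiner n d V T \<and>
    (\<forall>v\<in>carrier_vec d. homogeneous {1..n} k (T v)) \<and>
    (\<forall>v\<in>carrier_vec d. v \<noteq> 0\<^sub>v d \<longrightarrow> (\<exists>S\<subseteq>{1..n}. T v S \<noteq> 0)) \<and>
    (\<forall>c. \<exists>v\<in>carrier_vec d. T v = (\<lambda>S. \<Sum>ps\<in>pairings {1..n} k. c ps * polytabloid_fun {1..n} ps S))"
proof -
  obtain \<Phi> where bij: "bij_betw \<Phi> (carrier_vec d) (specht n (two_row n k))"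
    and add: "\<forall>v \<in> carrier_vec d. \<forall>w \<in> carrier_vec d. \<Phi> (v + w) = (\<lambda>T. \<Phi> v T + \<Phi> w T)"
    and smult: "\<forall>c. \<forall>v \<in> carrier_vec d. \<Phi> (c \<cdot>\<^sub>v v) = (\<lambda>T. c * \<Phi> v T)"
    and perm_act: "\<forall>p \<in> carrier (sym_group n). \<forall>v \<in> carrier_vec d. \<Phi> (V p *\<^sub>v v) = tabloid_action p (\<Phi> v)"
    using assms(2) by (auto simp: irrep_labelled_by_def equivalent_to_specht_def)
  have mem: "\<Phi> v \<in> specht n (two_row n k)" if "v \<in> carrier_vec d" for v
    using bij that by (auto simp: bij_betw_def)
  show ?thesis
  proof (intro exI[of _ "\<lambda>v. subset_fun n (\<Phi> v)"] conjI)
    show "intertwiner n d V (\<lambda>v. subset_fun n (\<Phi> v))"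
      unfolding intertwiner_def
    proof (intro conjI ballI allI impI)
      fix v w :: "complex vec" and c
      assume v: "v \<in> carrier_vec d"
      show "subset_fun n (\<Phi> (c \<cdot>\<^sub>v v)) = (\<lambda>S. c * subset_fun n (\<Phi> v) S)"
        using smult v by (simp add: subset_fun_def fun_eq_iff)
      show "subset_fun n (\<Phi> (V p *\<^sub>v v)) = perm_act p (subset_fun n (\<Phi> v))" if "p permutes {1..n}" for p
      proof -
        have "\<Phi> (V p *\<^sub>v v) = tabloid_action p (\<Phi> v)"
          using perm_act that v by (simp add: sym_group_def)
        then show ?thesis by (simp only: subset_fun_tabloid_action[OF that])
      qed
      assume "w \<in> carrier_vec d"
      then show "subset_fun n (\<Phi> (v + w)) = (\<lambda>S. subset_fun n (\<Phi> v) S + subset_fun n (\<Phi> w) S)"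
        using add v by (simp add: subset_fun_def fun_eq_iff)
    qed
    show "\<forall>v\<in>carrier_vec d. homogeneous {1..n} k (subset_fun n (\<Phi> v))"
      using homogeneous_subset_fun[OF assms(1) mem] by blast
    have nz: "\<exists>S\<subseteq>{1..n}. subset_fun n (\<Phi> v) S \<noteq> 0" if v: "v \<in> carrier_vec d" "v \<noteq> 0\<^sub>v d" for v
    proof (rule ccontr)
      assume "\<not> (\<exists>S\<subseteq>{1..n}. subset_fun n (\<Phi> v) S \<noteq> 0)"
      then have "\<Phi> v = (\<lambda>_. 0)"
        using subset_fun_eq_0[OF assms(1) mem[OF v(1)]] by blast
      moreover have "\<Phi> (0 \<cdot>\<^sub>v 0\<^sub>v d) = (\<lambda>_. 0)"
        using smult by simp
      moreover have "0 \<cdot>\<^sub>v 0\<^sub>v d = (0\<^sub>v d :: complex vec)" by (intro eq_vecI) auto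
      ultimately have "v = 0\<^sub>v d"
        using bij v(1) by (metis bij_betw_imp_inj_on inj_onD zero_carrier_vec)
      then show False using v(2) by simp
    qed
    show "\<forall>v\<in>carrier_vec d. v \<noteq> 0\<^sub>v d \<longrightarrow> (\<exists>S\<subseteq>{1..n}. subset_fun n (\<Phi> v) S \<noteq> 0)"
      by (intro ballI impI nz)
    have "\<exists>v\<in>carrier_vec d. subset_fun n (\<Phi> v) =
        (\<lambda>S. \<Sum>ps\<in>pairings {1..n} k. c ps * polytabloid_fun {1..n} ps S)" for c
    proof -
      obtain F where F: "F \<in> specht n (two_row n k)"
        "subset_fun n F = (\<lambda>S. \<Sum>ps\<in>pairings {1..n} k. c ps * polytabloid_fun {1..n} ps S)"
        using ex_specht_subset_fun[OF assms(1)] by blast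
      have "F \<in> \<Phi> ` carrier_vec d"
        unfolding bij_betw_imp_surj_on[OF bij] by (rule F(1))
      then obtain v where v: "v \<in> carrier_vec d" "F = \<Phi> v" by (elim imageE)
      show ?thesis using F(2) unfolding v(2) by (intro bexI[OF _ v(1)])
    qed
    then show "\<forall>c. \<exists>v\<in>carrier_vec d. subset_fun n (\<Phi> v) =
        (\<lambda>S. \<Sum>ps\<in>pairings {1..n} k. c ps * polytabloid_fun {1..n} ps S)"
      by blast
  qed
qed

section \<open>Fidelities carried along intertwiners\<close>

lemma cscalar_prod_self:
  fixes v :: "complex vec"
  assumes "v \<in> carrier_vec d"
  shows "v \<bullet>c v = of_real (\<Sum>i\<in>{0..<d}. (cmod (v $ i))\<^sup>2)"
  using assms by (simp add: scalar_prod_def complex_norm_square del: of_real_power)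

text \<open>By Schur's lemma \<open>T\<close> multiplies inner products by a constant, so
  \<open>T v\<close> has the fidelities of the normalised \<open>v\<close>, scaled by that constant
  times the squared norm of \<open>v\<close>.\<close>

lemma intertwiner_in_cone:
  fixes lbl :: "'N::finite \<Rightarrow> nat"
  assumes n: "1 \<le> n" and lbl: "range lbl \<subseteq> {1..n}"
    and rep: "unitary_rep n d V" "irreducible_rep n d V"
    and T: "intertwiner n d V T"
    and K: "irrep_fidelities lbl d V \<subseteq> K" "K \<noteq> {}" and v: "v \<in> carrier_vec d"
  shows "in_cone K (sqnorm {1..n} (T v)) (fidelity_form {1..n} 1 lbl (T v))"
proof -
  obtain c where c: "0 \<le> c" "\<And>v w. v \<in> carrier_vec d \<Longrightarrow> w \<in> carrier_vec d \<Longrightarrow>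
      fun_inner {1..n} (T v) (T w) = of_real c * (v \<bullet>c w)"
    using schur_inner_product[OF rep T] by blast
  define r where "r = (\<Sum>i\<in>{0..<d}. (cmod (v $ i))\<^sup>2)"
  have vv: "v \<bullet>c v = of_real r" "0 \<le> r"
    using cscalar_prod_self[OF v] by (simp_all add: r_def sum_nonneg)
  show ?thesis
  proof (cases "r = 0")
    case True
    then have "fun_inner {1..n} (T v) (T v) = 0" using c(2)[OF v v] vv by simp
    then have z: "T v S = 0" if "S \<in> Pow {1..n}" for S
      using that by (simp add: fun_inner_self_eq_0)
    then have "fun_inner {1..n} f (T v) = 0" for f by (simp add: fun_inner_def)
    then show ?thesis
      using in_cone_zero[OF K(2)]
      by (simp add: fidelity_form_def Finite_Cartesian_Product.vec_eq_iff flip: Finite_Cartesian_Product.zero_vec_def)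
  next
    case False
    define u where "u = of_real (1 / sqrt r) \<cdot>\<^sub>v v"
    have u: "u \<in> carrier_vec d" using v by (simp add: u_def)
    have scale: "(x \<bullet>c u) = of_real (1 / sqrt r) * (x \<bullet>c v)" if "x \<in> carrier_vec d" for x
      using that v by (simp add: u_def conjugate_smult_vec)
    have rr: "of_real (1 / sqrt r) * of_real (1 / sqrt r) = (of_real (1 / r) :: complex)"
      using vv(2) by (simp flip: of_real_mult)
    have uu: "u \<bullet>c u = 1"
    proof -
      have "u \<bullet>c u = of_real (1 / sqrt r) * of_real (1 / sqrt r) * (v \<bullet>c v)"
        unfolding scale[OF u] using v by (simp add: u_def)
      then show ?thesis using False unfolding rr vv(1) by simp
    qed
    define y where "y = (\<chi> a. 1 / 2 - 1 / 2 * Re (expval (V (Transposition.transpose 1 (lbl a))) u))"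
    have "y \<in> K"
      using K(1) u uu by (auto simp: y_def irrep_fidelities_def)
    moreover have "fidelity_form {1..n} 1 lbl (T v) = (c * r) *\<^sub>R y"
    proof -
      have "Re (fun_inner {1..n} (perm_act (Transposition.transpose 1 (lbl a)) (T v)) (T v))
          = c * r * Re (expval (V (Transposition.transpose 1 (lbl a))) u)" for a
      proof -
        let ?p = "Transposition.transpose 1 (lbl a)"
        have p: "?p permutes {1..n}"
          using n lbl by (intro permutes_swap_id) (auto simp: image_subset_iff)
        then have "unitary_mat d (V ?p)" using rep by (auto simp: unitary_rep_def sym_group_def)
        note U = unitary_mat_mult_adjoint(1)[OF this]
        have "expval (V ?p) u = of_real (1 / sqrt r) * of_real (1 / sqrt r) * ((V ?p *\<^sub>v v) \<bullet>c v)"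
          unfolding expval_def using U u v
          by (subst scale) (auto simp: u_def mult_mat_vec)
        then have "of_real r * expval (V ?p) u = (V ?p *\<^sub>v v) \<bullet>c v"
          unfolding rr using False by simp
        moreover have "fun_inner {1..n} (perm_act ?p (T v)) (T v) = of_real c * ((V ?p *\<^sub>v v) \<bullet>c v)"
          using c(2)[of "V ?p *\<^sub>v v" v] intertwinerD(3)[OF T v p] U v by simp
        ultimately have "fun_inner {1..n} (perm_act ?p (T v)) (T v) = of_real (c * r) * expval (V ?p) u"
          by (simp add: mult.assoc)
        then show ?thesis by simp
      qed
      then show ?thesis
        using c(2)[OF v v] vv
        by (simp add: fidelity_form_def y_def Finite_Cartesian_Product.vec_eq_iff algebra_simps)
    qed
    moreover have "sqnorm {1..n} (T v) = c * r" using c(2)[OF v v] vv by simp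
    ultimately show ?thesis using c(1) vv(2) by (auto simp: in_cone_def)
  qed
qed

lemma irrep_fidelities_nonempty:
  assumes "irreducible_rep n d V"
  shows "irrep_fidelities lbl d V \<noteq> {}"
proof -
  have "0 < d" using assms by (simp add: irreducible_rep_def)
  then have "unit_vec d 0 \<bullet>c unit_vec d 0 = (1 :: complex)"
    using cscalar_prod_unit_vec[of "unit_vec d 0" d 0] by simp
  then show ?thesis
    unfolding irrep_fidelities_def using unit_vec_carrier[of d 0] by blast
qed

text \<open>Injectivity makes the Schur constant positive. Dividing the intertwiner by its root
  gives an isometry, which preserves the expectations of permutations.\<close>

lemma irrep_fidelities_homogeneous:
  fixes lbl :: "'N::finite \<Rightarrow> nat"
  assumes n: "1 \<le> n" and lbl: "range lbl \<subseteq> {1..n}" and k: "2 * k \<le> n"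
    and irr: "irrep_labelled_by n (two_row n k) d V" and y: "y \<in> irrep_fidelities lbl d V"
  obtains f where "homogeneous {1..n} k f" "fun_inner {1..n} f f = 1" "fidelity_form {1..n} 1 lbl f = y"
proof -
  obtain \<psi> where \<psi>: "\<psi> \<in> carrier_vec d" "\<psi> \<bullet>c \<psi> = 1"
    and y: "y = (\<chi> a. 1 / 2 - 1 / 2 * Re (expval (V (Transposition.transpose 1 (lbl a))) \<psi>))"
    using y by (auto simp: irrep_fidelities_def)
  from irrep_labelled_by_intertwiner[OF k irr] obtain T where T: "intertwiner n d V T"
    and hom: "\<forall>v\<in>carrier_vec d. homogeneous {1..n} k (T v)"
    and nz: "\<forall>v\<in>carrier_vec d. v \<noteq> 0\<^sub>v d \<longrightarrow> (\<exists>S\<subseteq>{1..n}. T v S \<noteq> 0)"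
    by (elim exE conjE)
  have rep: "unitary_rep n d V" "irreducible_rep n d V"
    using irr by (auto simp: irrep_labelled_by_def)
  obtain c where c: "0 \<le> c" "\<And>v w. v \<in> carrier_vec d \<Longrightarrow> w \<in> carrier_vec d \<Longrightarrow>
      fun_inner {1..n} (T v) (T w) = of_real c * (v \<bullet>c w)"
    using schur_inner_product[OF rep T] by blast
  have "\<psi> \<noteq> 0\<^sub>v d" using \<psi> by auto
  then obtain S where "S \<subseteq> {1..n}" "T \<psi> S \<noteq> 0" using nz \<psi>(1) by blast
  then have "fun_inner {1..n} (T \<psi>) (T \<psi>) \<noteq> 0" by (auto simp: fun_inner_self_eq_0)
  then have c0: "0 < c" using c(1) c(2)[OF \<psi>(1) \<psi>(1)] \<psi>(2) by (cases "c = 0") auto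
  define f where "f = (\<lambda>S. of_real (1 / sqrt c) * T \<psi> S)"
  have cc: "of_real (1 / sqrt c) * of_real (1 / sqrt c) = (of_real (1 / c) :: complex)"
    using c(1) by (simp flip: of_real_mult)
  have fun_inner_f: "fun_inner {1..n} (perm_act p f) f = expval (V p) \<psi>" if p: "p permutes {1..n}" for p
  proof -
    have "unitary_mat d (V p)" using rep p by (auto simp: unitary_rep_def sym_group_def)
    note U = unitary_mat_mult_adjoint(1)[OF this]
    have "fun_inner {1..n} (perm_act p f) f = of_real (1 / sqrt c) * of_real (1 / sqrt c) *
        fun_inner {1..n} (perm_act p (T \<psi>)) (T \<psi>)"
      unfolding f_def perm_act_scale fun_inner_scale_left fun_inner_scale_right by simp
    also have "fun_inner {1..n} (perm_act p (T \<psi>)) (T \<psi>) = of_real c * expval (V p) \<psi>"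
      using c(2)[of "V p *\<^sub>v \<psi>" \<psi>] intertwinerD(3)[OF T \<psi>(1) p] U \<psi>(1) by (simp add: expval_def)
    finally show ?thesis unfolding cc using c0 by simp
  qed
  have one: "fun_inner {1..n} f f = 1"
  proof -
    have "fun_inner {1..n} f f = of_real (1 / sqrt c) * of_real (1 / sqrt c) * fun_inner {1..n} (T \<psi>) (T \<psi>)"
      unfolding f_def fun_inner_scale_left fun_inner_scale_right by simp
    then show ?thesis unfolding cc c(2)[OF \<psi>(1) \<psi>(1)] \<psi>(2) using c0 by simp
  qed
  show ?thesis
  proof (rule that)
    show "homogeneous {1..n} k f" using hom \<psi>(1) by (auto simp: f_def homogeneous_def)
    show "fun_inner {1..n} f f = 1" by (rule one)
    have "Transposition.transpose 1 (lbl a) permutes {1..n}" for a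
      using n lbl by (intro permutes_swap_id) (auto simp: image_subset_iff)
    then have "fun_inner {1..n} (perm_act (Transposition.transpose 1 (lbl a)) f) f =
        expval (V (Transposition.transpose 1 (lbl a))) \<psi>" for a
      by (rule fun_inner_f)
    then show "fidelity_form {1..n} 1 lbl f = y"
      unfolding fidelity_form_def y one by simp
  qed
qed

text \<open>A power of \<open>upper\<close> after the embedding of a representation is itself an
  intertwiner, to which Schur's lemma applies with its own constant. This supplies the hypothesis of
  \<open>fidelity_form_in_cone\<close>.\<close>

lemma fidelity_form_in_hull_cone:
  fixes lbl :: "'N::finite \<Rightarrow> nat"
  assumes n: "1 \<le> n" and lbl: "range lbl \<subseteq> {1..n}"
    and irr: "\<And>\<mu>. \<mu> \<in> two_row_partitions n \<Longrightarrow> irrep_labelled_by n \<mu> (d \<mu>) (V \<mu>)"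
    and K: "K = convex hull (\<Union>\<mu> \<in> two_row_partitions n. irrep_fidelities lbl (d \<mu>) (V \<mu>))"
  shows "K \<noteq> {}" "in_cone K (sqnorm {1..n} f) (fidelity_form {1..n} 1 lbl f)"
proof -
  have part: "two_row n k \<in> two_row_partitions n" if "2 * k \<le> n" for k
    using two_row_partitions_eq[of n] n that by auto
  have sub: "irrep_fidelities lbl (d \<mu>) (V \<mu>) \<subseteq> K" if "\<mu> \<in> two_row_partitions n" for \<mu>
    unfolding K using that by (intro subset_trans[OF _ hull_subset]) auto
  show ne: "K \<noteq> {}"
    using irrep_fidelities_nonempty[of n "d (two_row n 0)" "V (two_row n 0)" lbl]
      irr[OF part[of 0]] sub[OF part[of 0]] by (auto simp: irrep_labelled_by_def)
  show "in_cone K (sqnorm {1..n} f) (fidelity_form {1..n} 1 lbl f)"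
  proof (rule fidelity_form_in_cone)
    fix k i c
    let ?g = "\<lambda>S. \<Sum>ps\<in>pairings {1..n} k. c ps * polytabloid_fun {1..n} ps S"
    show "in_cone K (sqnorm {1..n} ((upper {1..n} ^^ i) ?g)) (fidelity_form {1..n} 1 lbl ((upper {1..n} ^^ i) ?g))"
    proof (cases "2 * k \<le> n")
      case True
      let ?d = "d (two_row n k)" and ?V = "V (two_row n k)"
      note irrk = irr[OF part[OF True]]
      from irrep_labelled_by_intertwiner[OF True irrk] obtain T where T: "intertwiner n ?d ?V T"
        and span: "\<forall>c. \<exists>v\<in>carrier_vec ?d. T v = (\<lambda>S. \<Sum>ps\<in>pairings {1..n} k. c ps * polytabloid_fun {1..n} ps S)"
        by (elim exE conjE)
      obtain v where v: "v \<in> carrier_vec ?d" "T v = ?g"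
        using span[rule_format, of c] by (elim bexE)
      have "intertwiner n ?d ?V (\<lambda>v. (upper {1..n} ^^ i) (T v))"
        using T by (simp add: intertwiner_def upper_power_add upper_power_scale perm_act_upper_power)
      then have "in_cone K (sqnorm {1..n} ((upper {1..n} ^^ i) (T v)))
          (fidelity_form {1..n} 1 lbl ((upper {1..n} ^^ i) (T v)))"
        using irrk sub[OF part[OF True]] ne
        by (intro intertwiner_in_cone[OF n lbl _ _ _ _ _ v(1)]) (auto simp: irrep_labelled_by_def)
      then show ?thesis unfolding v(2) .
    next
      case False
      \<comment> \<open>\<open>k\<close> disjoint pairs would occupy \<open>2 * k\<close> elements
        of \<open>{1..n}\<close>.\<close>
      have "pairings {1..n} k = {}"
      proof (rule equals0I)
        fix ps
        assume "ps \<in> pairings {1..n} k"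
        then have "pair_elems ps \<subseteq> {1..n}" "card (pair_elems ps) = 2 * k"
          using pairing_subset[of "{1..n}" ps] by (auto simp: pairings_def card_pair_elems)
        then show False using card_mono[of "{1..n}" "pair_elems ps"] False by simp
      qed
      moreover have "(upper {1..n} ^^ i) (\<lambda>_. 0) = (\<lambda>_. 0)"
        using upper_power_scale[of i "{1..n}" 0 "\<lambda>_. 0"] by simp
      ultimately show ?thesis
        using in_cone_zero[OF ne] by (simp add: fidelity_form_zero)
    qed
  qed (use n lbl ne K in auto)
qed

section \<open>Density operators\<close>

definition one_positions :: "nat \<Rightarrow> nat \<Rightarrow> nat set" where
  "one_positions n i = {l \<in> {1..n}. qubit n i l}"

lemma bij_betw_one_positions: "bij_betw (one_positions n) {..<2 ^ n} (Pow {1..n})"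
proof -
  have inj: "inj_on (one_positions n) {..<2 ^ n}"
  proof (rule inj_onI)
    fix i j :: nat
    assume ij: "i \<in> {..<2 ^ n}" "j \<in> {..<2 ^ n}" "one_positions n i = one_positions n j"
    show "i = j"
    proof (rule bit_eqI)
      fix m
      show "bit i m \<longleftrightarrow> bit j m"
      proof (cases "m < n")
        case True
        then have "n - m \<in> one_positions n i \<longleftrightarrow> n - m \<in> one_positions n j" "n - m \<in> {1..n}" "n - (n - m) = m"
          using ij by auto
        then show ?thesis by (simp add: one_positions_def qubit_def)
      next
        case False
        have "take_bit n i = i" "take_bit n j = j" using ij by (simp_all add: take_bit_nat_eq_self)
        then show ?thesis using False by (metis bit_take_bit_iff)
      qed
    qed
  qed
  have "card (one_positions n ` {..<2 ^ n}) = card (Pow {1..n})"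
    by (simp add: card_image[OF inj] card_Pow)
  then have "one_positions n ` {..<2 ^ n} = Pow {1..n}"
    by (intro card_subset_eq) (auto simp: one_positions_def)
  then show ?thesis using inj by (simp add: bij_betw_def)
qed

definition index_of :: "nat \<Rightarrow> nat set \<Rightarrow> nat" where
  "index_of n = the_inv_into {..<2 ^ n} (one_positions n)"

lemma index_of_one_positions: "i < 2 ^ n \<Longrightarrow> index_of n (one_positions n i) = i"
  using bij_betw_one_positions[of n] by (simp add: index_of_def the_inv_into_f_f bij_betw_def)

lemma one_positions_index_of: "S \<subseteq> {1..n} \<Longrightarrow> one_positions n (index_of n S) = S"
  using bij_betw_one_positions[of n] by (simp add: index_of_def f_the_inv_into_f bij_betw_def)

lemma index_of_less: "S \<subseteq> {1..n} \<Longrightarrow> index_of n S < 2 ^ n"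
  using the_inv_into_into[of "one_positions n" "{..<2 ^ n}" S "{..<2 ^ n}"] bij_betw_one_positions[of n]
  by (simp add: index_of_def bij_betw_def)

lemma one_positions_subset: "one_positions n i \<subseteq> {1..n}"
  by (auto simp: one_positions_def)

lemma sum_one_positions: "(\<Sum>i\<in>{..<2 ^ n}. F (one_positions n i)) = (\<Sum>S\<in>Pow {1..n}. F S)"
  using bij_betw_one_positions by (rule sum.reindex_bij_betw)

text \<open>The operator in the coordinates used for Specht modules, where a transposition acts by
  preimages of subsets.\<close>

definition qubit_kernel :: "nat \<Rightarrow> complex mat \<Rightarrow> nat set \<Rightarrow> nat set \<Rightarrow> complex" where
  "qubit_kernel n \<rho> S T = \<rho> $$ (index_of n S, index_of n T)"

lemma partial_trace_kernel:
  assumes "set ks \<subseteq> {1..n}" "a < 2 ^ length ks" "b < 2 ^ length ks"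
  shows "partial_trace n ks \<rho> $$ (a, b) =
    (\<Sum>(S, T) \<in> {(S, T). S \<subseteq> {1..n} \<and> T \<subseteq> {1..n} \<and>
        (\<forall>l < length ks. ks ! l \<in> S \<longleftrightarrow> qubit (length ks) a (Suc l)) \<and>
        (\<forall>l < length ks. ks ! l \<in> T \<longleftrightarrow> qubit (length ks) b (Suc l)) \<and>
        (\<forall>l \<in> {1..n} - set ks. l \<in> S \<longleftrightarrow> l \<in> T)}. qubit_kernel n \<rho> S T)"
proof -
  have mem: "l \<in> one_positions n i \<longleftrightarrow> qubit n i l" if "l \<in> {1..n}" for l i
    using that by (simp add: one_positions_def)
  have mem': "l \<in> S \<longleftrightarrow> qubit n (index_of n S) l" if "l \<in> {1..n}" "S \<subseteq> {1..n}" for l S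
    using mem[OF that(1), of "index_of n S"] one_positions_index_of[OF that(2)] by simp
  have ks: "ks ! l \<in> {1..n}" if "l < length ks" for l
    using assms(1) that nth_mem by blast
  have "partial_trace n ks \<rho> $$ (a, b) = (\<Sum>(i, j) \<in> {(i, j). i < 2 ^ n \<and> j < 2 ^ n \<and>
           (\<forall>l < length ks. qubit n i (ks ! l) = qubit (length ks) a (Suc l)) \<and>
           (\<forall>l < length ks. qubit n j (ks ! l) = qubit (length ks) b (Suc l)) \<and>
           (\<forall>l \<in> {1..n} - set ks. qubit n i l = qubit n j l)}. \<rho> $$ (i, j))"
    using assms(2,3) by (simp add: partial_trace_def)
  also have "\<dots> = (\<Sum>(S, T) \<in> {(S, T). S \<subseteq> {1..n} \<and> T \<subseteq> {1..n} \<and>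
        (\<forall>l < length ks. ks ! l \<in> S \<longleftrightarrow> qubit (length ks) a (Suc l)) \<and>
        (\<forall>l < length ks. ks ! l \<in> T \<longleftrightarrow> qubit (length ks) b (Suc l)) \<and>
        (\<forall>l \<in> {1..n} - set ks. l \<in> S \<longleftrightarrow> l \<in> T)}. qubit_kernel n \<rho> S T)"
    by (rule sum.reindex_bij_witness[where i = "\<lambda>(S, T). (index_of n S, index_of n T)"
          and j = "\<lambda>(i, j). (one_positions n i, one_positions n j)"])
      (use ks mem mem' in \<open>auto simp: index_of_one_positions one_positions_index_of index_of_less qubit_kernel_def
          dest: subsetD[OF one_positions_subset]\<close>)
  finally show ?thesis .
qed

section \<open>The singlet fraction as an expectation of a transposition\<close>

text \<open>In the partial traces below, the constraints determine one index from the other, so the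
  double sum runs over a graph.\<close>

lemma sum_graph:
  assumes "\<And>x y. (x, y) \<in> R \<longleftrightarrow> y \<in> Q \<and> x = g y"
  shows "(\<Sum>(x, y)\<in>R. F x y) = (\<Sum>y\<in>Q. F (g y) y)"
proof -
  have "R = (\<lambda>y. (g y, y)) ` Q"
  proof (rule Set.set_eqI)
    fix z
    show "z \<in> R \<longleftrightarrow> z \<in> (\<lambda>y. (g y, y)) ` Q"
      using assms[of "fst z" "snd z"] by (auto simp: image_iff prod_eq_iff)
  qed
  moreover have "inj_on (\<lambda>y. (g y, y)) Q" by (rule inj_onI) simp
  ultimately show ?thesis by (simp add: sum.reindex)
qed

text \<open>Only the basis vectors number 1 (digits 01) and number 2 (digits 10) occur in the
  singlet, with opposite signs.\<close>

lemma expval_singlet: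
  assumes "M \<in> carrier_mat 4 4"
  shows "expval M singlet = 1 / 2 * (M $$ (1, 1) + M $$ (2, 2) - M $$ (1, 2) - M $$ (2, 1))"
proof -
  define s where "s = 1 / complex_of_real (sqrt 2)"
  have s: "s * cnj s = 1 / 2" by (simp add: s_def flip: of_real_mult)
  have v: "singlet $ 0 = 0" "singlet $ Suc 0 = s" "singlet $ 2 = - s" "singlet $ 3 = 0" "dim_vec singlet = 4"
    by (simp_all add: singlet_def s_def numeral_2_eq_2 numeral_3_eq_3 vec_of_list_index)
  have four: "{0..<4::nat} = {0, 1, 2, 3}" by auto
  have "expval M singlet = (\<Sum>i\<in>{0..<4}. (\<Sum>j\<in>{0..<4}. M $$ (i, j) * singlet $ j) * cnj (singlet $ i))"
    using assms v(5) by (simp add: expval_def scalar_prod_def)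
  also have "\<dots> = (s * cnj s) * (M $$ (1, 1) + M $$ (2, 2) - M $$ (1, 2) - M $$ (2, 1))"
    unfolding four by (simp add: v algebra_simps)
  finally show ?thesis by (simp add: s)
qed

text \<open>Subsets are sorted by whether they contain 1 and \<open>k\<close>. Where the answers
  agree, the transposition changes nothing and the two sums cancel; where they differ, it exchanges
  the two classes and yields the off-diagonal entries.\<close>

lemma fidelity_kernel:
  assumes k: "k \<in> {2..n}"
  shows "fidelity n k \<rho> = 1 / 2 * Re (\<Sum>S\<in>Pow {1..n}. qubit_kernel n \<rho> S S)
    - 1 / 2 * Re (\<Sum>S\<in>Pow {1..n}. qubit_kernel n \<rho> (Transposition.transpose 1 k -` S) S)"
proof -
  let ?X = "{1..n}" and ?A = "qubit_kernel n \<rho>" and ?t = "Transposition.transpose 1 k"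
  define P where "P = (\<lambda>p q. {S. S \<subseteq> ?X \<and> (1 \<in> S \<longleftrightarrow> p) \<and> (k \<in> S \<longleftrightarrow> q)})"
  let ?R = "\<lambda>p q p' q'. {(S, T). S \<subseteq> ?X \<and> T \<subseteq> ?X \<and> (1 \<in> S \<longleftrightarrow> p) \<and> (k \<in> S \<longleftrightarrow> q) \<and>
      (1 \<in> T \<longleftrightarrow> p') \<and> (k \<in> T \<longleftrightarrow> q') \<and> (\<forall>l\<in>?X - {1, k}. l \<in> S \<longleftrightarrow> l \<in> T)}"
  have q: "qubit 2 1 1 = False" "qubit 2 1 2 = True" "qubit 2 2 1 = True" "qubit 2 2 2 = False"
    by (simp_all add: qubit_def bit_nat_def)
  have M: "partial_trace n [1, k] \<rho> $$ (a, b) =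
      (\<Sum>(S, T)\<in>?R (qubit 2 a 1) (qubit 2 a 2) (qubit 2 b 1) (qubit 2 b 2). ?A S T)"
    if "a < 4" "b < 4" for a b
    using partial_trace_kernel[of "[1, k]" n a b \<rho>] that k
    by (simp add: All_less_Suc2 numeral_2_eq_2 conj_ac)
  have diag: "(\<Sum>(S, T)\<in>?R p q p q. ?A S T) = (\<Sum>S\<in>P p q. ?A S S)" for p q
  proof -
    have "S = T" if "(S, T) \<in> ?R p q p q" for S T
      using that by blast
    then have "(S, T) \<in> ?R p q p q \<longleftrightarrow> T \<in> P p q \<and> S = T" for S T
      unfolding P_def by blast
    then show ?thesis by (rule sum_graph)
  qed
  have swap: "?t -` T \<subseteq> ?X \<longleftrightarrow> T \<subseteq> ?X" for T
    using k by (intro vimage_permutes_subset permutes_swap_id) auto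
  \<comment> \<open>\<open>S\<close> and \<open>T\<close> agree outside 1 and \<open>k\<close> and
    have exchanged digits there, so each is the transposed other.\<close>
  have off: "(\<Sum>(S, T)\<in>?R (\<not> p) p p (\<not> p). ?A S T) = (\<Sum>T\<in>P p (\<not> p). ?A (?t -` T) T)" for p
  proof -
    have eq: "S = ?t -` T" if "(S, T) \<in> ?R (\<not> p) p p (\<not> p)" for S T
    proof (rule Set.set_eqI)
      fix l
      show "l \<in> S \<longleftrightarrow> l \<in> ?t -` T"
        using that by (cases "l = 1"; cases "l = k"; cases "l \<in> ?X") (auto simp: transpose_apply_other)
    qed
    have mem: "(?t -` T, T) \<in> ?R (\<not> p) p p (\<not> p)" if "T \<in> P p (\<not> p)" for T
      using that swap[of T] by (auto simp: P_def transpose_apply_other)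
    have "(S, T) \<in> ?R (\<not> p) p p (\<not> p) \<longleftrightarrow> T \<in> P p (\<not> p) \<and> S = ?t -` T" for S T
    proof
      assume R: "(S, T) \<in> ?R (\<not> p) p p (\<not> p)"
      then have "T \<in> P p (\<not> p)" unfolding P_def by blast
      then show "T \<in> P p (\<not> p) \<and> S = ?t -` T" using eq[OF R] by blast
    next
      assume "T \<in> P p (\<not> p) \<and> S = ?t -` T"
      then show "(S, T) \<in> ?R (\<not> p) p p (\<not> p)" using mem[of T] by blast
    qed
    then show ?thesis by (rule sum_graph)
  qed
  have fin: "finite (P p q)" for p q
    by (rule finite_subset[of _ "Pow ?X"]) (auto simp: P_def)
  have Pow: "Pow ?X = (P True True \<union> P False False) \<union> (P True False \<union> P False True)"
    by (auto simp: P_def)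
  have sum_Pow: "(\<Sum>S\<in>Pow ?X. F S) = (\<Sum>S\<in>P True True \<union> P False False. F S)
     + ((\<Sum>S\<in>P True False. F S) + (\<Sum>S\<in>P False True. F S))" for F :: "nat set \<Rightarrow> complex"
    unfolding Pow
    by (subst sum.union_disjoint, simp add: fin, simp add: fin, force simp: P_def,
        subst (2) sum.union_disjoint) (auto simp: fin P_def)
  have same: "(\<Sum>S\<in>P True True \<union> P False False. ?A (?t -` S) S) = (\<Sum>S\<in>P True True \<union> P False False. ?A S S)"
  proof (intro sum.cong refl)
    fix S
    assume S: "S \<in> P True True \<union> P False False"
    have "?t -` S = S"
    proof (rule Set.set_eqI)
      fix l
      show "l \<in> ?t -` S \<longleftrightarrow> l \<in> S"
        using S by (cases "l = 1"; cases "l = k") (auto simp: P_def transpose_apply_other)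
    qed
    then show "?A (?t -` S) S = ?A S S" by simp
  qed
  have lt: "1 < (4 :: nat)" "2 < (4 :: nat)" by simp_all
  have entries:
    "partial_trace n [1, k] \<rho> $$ (1, 1) = (\<Sum>S\<in>P False True. ?A S S)"
    "partial_trace n [1, k] \<rho> $$ (2, 2) = (\<Sum>S\<in>P True False. ?A S S)"
    "partial_trace n [1, k] \<rho> $$ (1, 2) = (\<Sum>S\<in>P True False. ?A (?t -` S) S)"
    "partial_trace n [1, k] \<rho> $$ (2, 1) = (\<Sum>S\<in>P False True. ?A (?t -` S) S)"
    using off[of True] off[of False]
    by (simp_all only: M lt q diag not_True_eq_False not_False_eq_True)
  have "partial_trace n [1, k] \<rho> \<in> carrier_mat 4 4" by (simp add: partial_trace_def)
  from expval_singlet[OF this]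
  have "expval (partial_trace n [1, k] \<rho>) singlet =
     1 / 2 * ((\<Sum>S\<in>P False True. ?A S S) + (\<Sum>S\<in>P True False. ?A S S)
       - (\<Sum>S\<in>P True False. ?A (?t -` S) S) - (\<Sum>S\<in>P False True. ?A (?t -` S) S))"
    unfolding entries by simp
  also have "\<dots> = 1 / 2 * ((\<Sum>S\<in>Pow ?X. ?A S S) - (\<Sum>S\<in>Pow ?X. ?A (?t -` S) S))"
    unfolding sum_Pow same by simp
  finally have expval: "expval (partial_trace n [1, k] \<rho>) singlet =
      1 / 2 * ((\<Sum>S\<in>Pow ?X. ?A S S) - (\<Sum>S\<in>Pow ?X. ?A (?t -` S) S))" .
  show ?thesis unfolding fidelity_def expval by simp
qed

section \<open>Admissible vectors lie in the convex hull\<close>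

lemma density_operator_decomposition:
  assumes "density_operator (2 ^ n) \<rho>"
  shows "\<exists>(m :: nat) w.
    (\<forall>S\<in>Pow {1..n}. \<forall>T\<in>Pow {1..n}. qubit_kernel n \<rho> S T = (\<Sum>l<m. w l S * cnj (w l T))) \<and>
    (\<Sum>l<m. fun_inner {1..n} (w l) (w l)) = 1"
proof -
  let ?X = "{1..n}"
  have \<rho>: "\<rho> \<in> carrier_mat (2 ^ n) (2 ^ n)" and pos: "\<And>v. v \<in> carrier_vec (2 ^ n) \<Longrightarrow> 0 \<le> expval \<rho> v"
    and tr: "(\<Sum>i<2 ^ n. \<rho> $$ (i, i)) = 1"
    using assms by (auto simp: density_operator_def)
  have "0 \<le> (\<Sum>S\<in>Pow ?X. \<Sum>T\<in>Pow ?X. cnj (v S) * qubit_kernel n \<rho> S T * v T)" for v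
  proof -
    let ?u = "vec (2 ^ n) (\<lambda>i. v (one_positions n i))"
    have "expval \<rho> ?u = (\<Sum>i\<in>{..<2 ^ n}. \<Sum>j\<in>{..<2 ^ n}. cnj (v (one_positions n i)) * qubit_kernel n \<rho> (one_positions n i) (one_positions n j) * v (one_positions n j))"
      using \<rho> by (simp add: expval_def scalar_prod_def sum_distrib_left qubit_kernel_def index_of_one_positions
          atLeast0LessThan mult_ac)
    also have "\<dots> = (\<Sum>S\<in>Pow ?X. \<Sum>T\<in>Pow ?X. cnj (v S) * qubit_kernel n \<rho> S T * v T)"
      using sum_one_positions[of "\<lambda>S. \<Sum>j\<in>{..<2 ^ n}. cnj (v S) * qubit_kernel n \<rho> S (one_positions n j) * v (one_positions n j)" n]
      by (simp add: sum_one_positions[of "\<lambda>T. cnj (v _) * qubit_kernel n \<rho> _ T * v T"])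
    finally show ?thesis using pos[of ?u] by simp
  qed
  then obtain m :: nat and w where
    w: "\<forall>S\<in>Pow ?X. \<forall>T\<in>Pow ?X. qubit_kernel n \<rho> S T = (\<Sum>l<m. w l S * cnj (w l T))"
    using psd_sum_of_rank_one[of "Pow ?X" "qubit_kernel n \<rho>"] by auto
  have "(\<Sum>l<m. fun_inner ?X (w l) (w l)) = (\<Sum>S\<in>Pow ?X. \<Sum>l<m. w l S * cnj (w l S))"
    unfolding fun_inner_def by (rule sum.swap)
  also have "\<dots> = (\<Sum>S\<in>Pow ?X. qubit_kernel n \<rho> S S)" using w by simp
  also have "\<dots> = (\<Sum>i\<in>{..<2 ^ n}. qubit_kernel n \<rho> (one_positions n i) (one_positions n i))" by (rule sum_one_positions[symmetric])
  also have "\<dots> = 1" using tr by (simp add: qubit_kernel_def index_of_one_positions)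
  finally show ?thesis using w by blast
qed

text \<open>The squared norms of the rank-one terms add up to the trace 1, and at weight 1 the cone
  is the hull itself.\<close>

lemma admissible_fidelities_subset:
  fixes lbl :: "'N::finite \<Rightarrow> nat"
  assumes n: "1 \<le> n" and lbl: "range lbl \<subseteq> {2..n}"
    and irr: "\<And>\<mu>. \<mu> \<in> two_row_partitions n \<Longrightarrow> irrep_labelled_by n \<mu> (d \<mu>) (V \<mu>)"
  shows "admissible_fidelities n lbl \<subseteq>
    convex hull (\<Union>\<mu> \<in> two_row_partitions n. irrep_fidelities lbl (d \<mu>) (V \<mu>))"
proof
  fix x
  let ?X = "{1..n}"
  define K where "K = convex hull (\<Union>\<mu> \<in> two_row_partitions n. irrep_fidelities lbl (d \<mu>) (V \<mu>))"
  assume "x \<in> admissible_fidelities n lbl"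
  then obtain \<rho> where \<rho>: "density_operator (2 ^ n) \<rho>" and x: "x = (\<chi> a. fidelity n (lbl a) \<rho>)"
    by (auto simp: admissible_fidelities_def)
  from density_operator_decomposition[OF \<rho>] obtain m :: nat and w where
    w: "\<forall>S\<in>Pow ?X. \<forall>T\<in>Pow ?X. qubit_kernel n \<rho> S T = (\<Sum>l<m. w l S * cnj (w l T))"
    and tr: "(\<Sum>l<m. fun_inner ?X (w l) (w l)) = 1"
    by (elim exE conjE)
  have lbl': "range lbl \<subseteq> ?X" using lbl by fastforce
  note cone = fidelity_form_in_hull_cone[OF n lbl' irr K_def]
  have "in_cone K (\<Sum>l<m. sqnorm ?X (w l)) (\<Sum>l<m. fidelity_form ?X 1 lbl (w l))"
    using cone by (intro in_cone_sum) (auto simp: K_def)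
  moreover have "(\<Sum>l<m. sqnorm ?X (w l)) = 1"
    using arg_cong[OF tr, of Re] by simp
  moreover have "(\<Sum>l<m. fidelity_form ?X 1 lbl (w l)) = x"
  proof -
    have "fidelity n (lbl a) \<rho> = (\<Sum>l<m. 1 / 2 * sqnorm ?X (w l)
       - 1 / 2 * Re (fun_inner ?X (perm_act (Transposition.transpose 1 (lbl a)) (w l)) (w l)))" for a
    proof -
      let ?t = "Transposition.transpose 1 (lbl a)"
      have a: "lbl a \<in> {2..n}" using lbl by blast
      have "?t permutes ?X" using a by (intro permutes_swap_id) auto
      then have "?t -` S \<subseteq> ?X" if "S \<subseteq> ?X" for S
        using vimage_permutes_subset that by blast
      then have "(\<Sum>S\<in>Pow ?X. qubit_kernel n \<rho> (?t -` S) S) = (\<Sum>S\<in>Pow ?X. \<Sum>l<m. w l (?t -` S) * cnj (w l S))"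
        using w by (intro sum.cong) auto
      also have "\<dots> = (\<Sum>l<m. fun_inner ?X (perm_act ?t (w l)) (w l))"
        unfolding fun_inner_def perm_act_def by (rule sum.swap)
      finally have 1: "(\<Sum>S\<in>Pow ?X. qubit_kernel n \<rho> (?t -` S) S) = (\<Sum>l<m. fun_inner ?X (perm_act ?t (w l)) (w l))" .
      have "(\<Sum>S\<in>Pow ?X. qubit_kernel n \<rho> S S) = (\<Sum>S\<in>Pow ?X. \<Sum>l<m. w l S * cnj (w l S))"
        using w by (intro sum.cong) auto
      also have "\<dots> = (\<Sum>l<m. fun_inner ?X (w l) (w l))"
        unfolding fun_inner_def by (rule sum.swap)
      finally show ?thesis
        unfolding fidelity_kernel[OF a] 1 by (simp add: sum_subtractf sum_divide_distrib)
    qed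
    then show ?thesis
      by (simp add: x fidelity_form_def Finite_Cartesian_Product.vec_eq_iff)
  qed
  ultimately show "x \<in> convex hull (\<Union>\<mu> \<in> two_row_partitions n. irrep_fidelities lbl (d \<mu>) (V \<mu>))"
    by (simp add: in_cone_one K_def)
qed

section \<open>Convexity, and admissibility of vectors from the representations\<close>

lemma expval_linear:
  assumes "A \<in> carrier_mat m m" "B \<in> carrier_mat m m" "v \<in> carrier_vec m"
  shows "expval (a \<cdot>\<^sub>m A + b \<cdot>\<^sub>m B) v = a * expval A v + b * expval B v"
proof -
  have "(a \<cdot>\<^sub>m A + b \<cdot>\<^sub>m B) *\<^sub>v v = a \<cdot>\<^sub>v (A *\<^sub>v v) + b \<cdot>\<^sub>v (B *\<^sub>v v)"
    using assms by (intro eq_vecI) (auto simp: scalar_prod_def sum.distrib sum_distrib_left algebra_simps)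
  moreover have "(a \<cdot>\<^sub>v x + b \<cdot>\<^sub>v y) \<bullet>c v = a * (x \<bullet>c v) + b * (y \<bullet>c v)"
    if "x \<in> carrier_vec m" "y \<in> carrier_vec m" for x y
    using that assms(3) by (simp add: add_scalar_prod_distrib[of _ m])
  ultimately show ?thesis using assms by (simp add: expval_def)
qed

lemma partial_trace_linear:
  assumes "\<rho> \<in> carrier_mat (2 ^ n) (2 ^ n)" "\<sigma> \<in> carrier_mat (2 ^ n) (2 ^ n)"
  shows "partial_trace n ks (a \<cdot>\<^sub>m \<rho> + b \<cdot>\<^sub>m \<sigma>) = a \<cdot>\<^sub>m partial_trace n ks \<rho> + b \<cdot>\<^sub>m partial_trace n ks \<sigma>"
proof (rule eq_matI)
  fix i j
  assume ij: "i < dim_row (a \<cdot>\<^sub>m partial_trace n ks \<rho> + b \<cdot>\<^sub>m partial_trace n ks \<sigma>)"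
    "j < dim_col (a \<cdot>\<^sub>m partial_trace n ks \<rho> + b \<cdot>\<^sub>m partial_trace n ks \<sigma>)"
  define R where "R = {(x, y). x < 2 ^ n \<and> y < 2 ^ n \<and>
           (\<forall>l < length ks. qubit n x (ks ! l) = qubit (length ks) i (Suc l)) \<and>
           (\<forall>l < length ks. qubit n y (ks ! l) = qubit (length ks) j (Suc l)) \<and>
           (\<forall>l \<in> {1..n} - set ks. qubit n x l = qubit n y l)}"
  have dims: "dim_row (partial_trace n ks \<tau>) = 2 ^ length ks" "dim_col (partial_trace n ks \<tau>) = 2 ^ length ks" for \<tau>
    by (simp_all add: partial_trace_def)
  have entry: "partial_trace n ks \<tau> $$ (i, j) = (\<Sum>(x, y)\<in>R. \<tau> $$ (x, y))" for \<tau>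
    using ij by (simp add: partial_trace_def R_def)
  have "(\<Sum>(x, y)\<in>R. (a \<cdot>\<^sub>m \<rho> + b \<cdot>\<^sub>m \<sigma>) $$ (x, y)) = (\<Sum>(x, y)\<in>R. a * \<rho> $$ (x, y) + b * \<sigma> $$ (x, y))"
    by (intro sum.cong refl) (use assms in \<open>auto simp: R_def\<close>)
  also have "\<dots> = a * (\<Sum>(x, y)\<in>R. \<rho> $$ (x, y)) + b * (\<Sum>(x, y)\<in>R. \<sigma> $$ (x, y))"
    by (simp add: split_beta sum.distrib sum_distrib_left)
  finally show "partial_trace n ks (a \<cdot>\<^sub>m \<rho> + b \<cdot>\<^sub>m \<sigma>) $$ (i, j) =
      (a \<cdot>\<^sub>m partial_trace n ks \<rho> + b \<cdot>\<^sub>m partial_trace n ks \<sigma>) $$ (i, j)"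
    using ij by (simp add: entry dims)
qed (simp_all add: partial_trace_def)

lemma convex_admissible_fidelities:
  "convex (admissible_fidelities n (lbl :: 'N::finite \<Rightarrow> nat))"
proof (rule convexI)
  fix x y :: "real ^ 'N" and u v :: real
  assume x: "x \<in> admissible_fidelities n lbl" and y: "y \<in> admissible_fidelities n lbl"
    and uv: "0 \<le> u" "0 \<le> v" "u + v = 1"
  obtain \<rho> where \<rho>: "density_operator (2 ^ n) \<rho>" "partial_trace n [1] \<rho> = (1 / 2) \<cdot>\<^sub>m 1\<^sub>m 2"
    and x: "x = (\<chi> a. fidelity n (lbl a) \<rho>)" using x by (auto simp: admissible_fidelities_def)
  obtain \<sigma> where \<sigma>: "density_operator (2 ^ n) \<sigma>" "partial_trace n [1] \<sigma> = (1 / 2) \<cdot>\<^sub>m 1\<^sub>m 2"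
    and y: "y = (\<chi> a. fidelity n (lbl a) \<sigma>)" using y by (auto simp: admissible_fidelities_def)
  have c: "\<rho> \<in> carrier_mat (2 ^ n) (2 ^ n)" "\<sigma> \<in> carrier_mat (2 ^ n) (2 ^ n)"
    using \<rho> \<sigma> by (auto simp: density_operator_def)
  define \<tau> where "\<tau> = complex_of_real u \<cdot>\<^sub>m \<rho> + complex_of_real v \<cdot>\<^sub>m \<sigma>"
  have uv': "complex_of_real u + complex_of_real v = 1" using uv(3) by (simp flip: of_real_add)
  have "0 \<le> expval \<tau> w" if "w \<in> carrier_vec (2 ^ n)" for w
  proof -
    have "0 \<le> expval \<rho> w" "0 \<le> expval \<sigma> w"
      using \<rho> \<sigma> that by (auto simp: density_operator_def)
    then show ?thesis
      using uv expval_linear[OF c that, of "complex_of_real u" "complex_of_real v"]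
      by (simp add: \<tau>_def less_eq_complex_def)
  qed
  moreover have "(\<Sum>i<2 ^ n. \<tau> $$ (i, i)) = 1"
  proof -
    have "(\<Sum>i<2 ^ n. \<tau> $$ (i, i)) =
       complex_of_real u * (\<Sum>i<2 ^ n. \<rho> $$ (i, i)) + complex_of_real v * (\<Sum>i<2 ^ n. \<sigma> $$ (i, i))"
      using c by (simp add: \<tau>_def sum.distrib sum_distrib_left)
    then show ?thesis using \<rho> \<sigma> uv' by (simp add: density_operator_def)
  qed
  ultimately have "density_operator (2 ^ n) \<tau>"
    using c by (auto simp: density_operator_def \<tau>_def)
  moreover have "partial_trace n [1] \<tau> = (1 / 2) \<cdot>\<^sub>m 1\<^sub>m 2"
  proof -
    have "partial_trace n [1] \<tau> = complex_of_real u \<cdot>\<^sub>m ((1 / 2) \<cdot>\<^sub>m 1\<^sub>m 2) + complex_of_real v \<cdot>\<^sub>m ((1 / 2) \<cdot>\<^sub>m 1\<^sub>m 2)"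
      unfolding \<tau>_def partial_trace_linear[OF c] \<rho>(2) \<sigma>(2) by simp
    also have "\<dots> = (complex_of_real u + complex_of_real v) \<cdot>\<^sub>m ((1 / 2) \<cdot>\<^sub>m 1\<^sub>m 2)"
      by (intro eq_matI) (auto simp: algebra_simps)
    also have "\<dots> = (1 / 2) \<cdot>\<^sub>m 1\<^sub>m 2"
      unfolding uv' by (intro eq_matI) auto
    finally show ?thesis .
  qed
  moreover have "fidelity n k \<tau> = u * fidelity n k \<rho> + v * fidelity n k \<sigma>" for k
  proof -
    have p: "partial_trace n [1, k] \<rho> \<in> carrier_mat 4 4" "partial_trace n [1, k] \<sigma> \<in> carrier_mat 4 4"
      "singlet \<in> carrier_vec 4"
      by (simp_all add: partial_trace_def singlet_def carrier_vecI)
    show ?thesis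
      unfolding fidelity_def \<tau>_def partial_trace_linear[OF c] expval_linear[OF p] by simp
  qed
  ultimately show "u *\<^sub>R x + v *\<^sub>R y \<in> admissible_fidelities n lbl"
    unfolding admissible_fidelities_def x y
    by (intro CollectI exI[of _ \<tau>]) (simp add: Finite_Cartesian_Product.vec_eq_iff)
qed

text \<open>
  Averaging a weight vector with its image under flipping all qubits makes the first marginal
  maximally mixed without changing the fidelities.
\<close>

lemma homogeneous_fidelities_admissible:
  fixes lbl :: "'N::finite \<Rightarrow> nat"
  assumes n: "1 \<le> n" and lbl: "range lbl \<subseteq> {2..n}"
    and hom: "homogeneous {1..n} k f" and norm: "fun_inner {1..n} f f = 1"
  shows "fidelity_form {1..n} 1 lbl f \<in> admissible_fidelities n lbl"
proof -
  let ?X = "{1..n}"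
  \<comment> \<open>The complement of a subset is the basis vector with all qubits flipped.\<close>
  define A where "A = (\<lambda>S T. 1 / 2 * (f S * cnj (f T) + f (?X - S) * cnj (f (?X - T))))"
  define \<rho> where "\<rho> = mat (2 ^ n) (2 ^ n) (\<lambda>(i, j). A (one_positions n i) (one_positions n j))"
  have kern: "qubit_kernel n \<rho> S T = A S T" if "S \<subseteq> ?X" "T \<subseteq> ?X" for S T
    using that by (simp add: qubit_kernel_def \<rho>_def index_of_less one_positions_index_of)
  have compl: "(\<Sum>S\<in>Pow ?X. F (?X - S)) = (\<Sum>S\<in>Pow ?X. F S)" for F :: "nat set \<Rightarrow> complex"
    by (rule sum.reindex_bij_witness[of _ "\<lambda>S. ?X - S" "\<lambda>S. ?X - S"]) (auto simp: double_diff)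
  have trA: "(\<Sum>S\<in>Pow ?X. A S S) = 1"
    using norm compl[of "\<lambda>S. f S * cnj (f S)"]
    by (simp add: A_def fun_inner_def sum.distrib sum_divide_distrib[symmetric])
  have "0 \<le> expval \<rho> v" if v: "v \<in> carrier_vec (2 ^ n)" for v
  proof -
    define a where "a = (\<Sum>i\<in>{..<2 ^ n}. cnj (v $ i) * f (one_positions n i))"
    define b where "b = (\<Sum>i\<in>{..<2 ^ n}. cnj (v $ i) * f (?X - one_positions n i))"
    have "expval \<rho> v = (\<Sum>i\<in>{..<2 ^ n}. \<Sum>j\<in>{..<2 ^ n}. A (one_positions n i) (one_positions n j) * v $ j * cnj (v $ i))"
      using v by (simp add: expval_def scalar_prod_def \<rho>_def sum_distrib_right atLeast0LessThan)
    also have "\<dots> = (\<Sum>i\<in>{..<2 ^ n}. \<Sum>j\<in>{..<2 ^ n}. 1 / 2 *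
        ((cnj (v $ i) * f (one_positions n i)) * cnj (cnj (v $ j) * f (one_positions n j)) +
         (cnj (v $ i) * f (?X - one_positions n i)) * cnj (cnj (v $ j) * f (?X - one_positions n j))))"
      by (intro sum.cong refl) (simp add: A_def field_simps)
    also have "\<dots> = 1 / 2 * (a * cnj a + b * cnj b)"
      unfolding a_def b_def cnj_sum sum_product by (simp only: sum_distrib_left[symmetric] sum.distrib)
    also have "\<dots> = of_real (1 / 2 * ((cmod a)\<^sup>2 + (cmod b)\<^sup>2))"
      by (simp add: complex_norm_square del: of_real_power)
    finally have expval: "expval \<rho> v = of_real (1 / 2 * ((cmod a)\<^sup>2 + (cmod b)\<^sup>2))" .
    have nonneg: "0 \<le> complex_of_real r" if "0 \<le> r" for r
      using that by (simp add: less_eq_complex_def)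
    show ?thesis unfolding expval by (rule nonneg) simp
  qed
  moreover have "(\<Sum>i<2 ^ n. \<rho> $$ (i, i)) = 1"
    using trA sum_one_positions[of "\<lambda>S. A S S" n] by (simp add: \<rho>_def)
  ultimately have dens: "density_operator (2 ^ n) \<rho>"
    by (auto simp: density_operator_def \<rho>_def)
  have marg: "partial_trace n [1] \<rho> = (1 / 2) \<cdot>\<^sub>m 1\<^sub>m 2"
  proof (rule eq_matI)
    fix a b
    assume "a < dim_row ((1 / 2) \<cdot>\<^sub>m 1\<^sub>m 2 :: complex mat)" "b < dim_col ((1 / 2) \<cdot>\<^sub>m 1\<^sub>m 2 :: complex mat)"
    then have ab: "a < 2" "b < 2" by auto
    let ?R = "{(S, T). S \<subseteq> ?X \<and> T \<subseteq> ?X \<and> (1 \<in> S \<longleftrightarrow> a = 1) \<and> (1 \<in> T \<longleftrightarrow> b = 1) \<and>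
        (\<forall>l\<in>?X - {1}. l \<in> S \<longleftrightarrow> l \<in> T)}"
    have q: "qubit 1 c 1 \<longleftrightarrow> c = 1" if "c < 2" for c
      using that by (auto simp: qubit_def less_2_cases_iff bit_0)
    have "partial_trace n [1] \<rho> $$ (a, b) = (\<Sum>(S, T)\<in>?R. qubit_kernel n \<rho> S T)"
      using partial_trace_kernel[of "[1]" n a b \<rho>] ab n q by simp
    also have "\<dots> = (\<Sum>(S, T)\<in>?R. A S T)"
      by (intro sum.cong refl) (auto simp: kern)
    also have "\<dots> = (if a = b then 1 / 2 else 0)"
    proof (cases "a = b")
      case True
      define Q where "Q = (\<lambda>p. {S. S \<subseteq> ?X \<and> (1 \<in> S \<longleftrightarrow> p)})"
      have eq: "S = T" if "(S, T) \<in> ?R" for S T using that True by blast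
      let ?g = "\<lambda>S. f S * cnj (f S)"
      have "(S, T) \<in> ?R \<longleftrightarrow> T \<in> Q (a = 1) \<and> S = T" for S T
        unfolding Q_def using eq True by blast
      then have "(\<Sum>(S, T)\<in>?R. A S T) = (\<Sum>S\<in>Q (a = 1). A S S)" by (rule sum_graph)
      also have "\<dots> = 1 / 2 * ((\<Sum>S\<in>Q (a = 1). ?g S) + (\<Sum>S\<in>Q (a = 1). ?g (?X - S)))"
        by (simp add: A_def sum.distrib sum_divide_distrib add_divide_distrib)
      \<comment> \<open>Complementation exchanges the subsets containing 1 with the others, so each
        diagonal entry is half of the total squared norm.\<close>
      also have "(\<Sum>S\<in>Q (a = 1). ?g (?X - S)) = (\<Sum>S\<in>Q (a \<noteq> 1). ?g S)"
        by (rule sum.reindex_bij_witness[of _ "\<lambda>S. ?X - S" "\<lambda>S. ?X - S"])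
          (use n in \<open>auto simp: Q_def double_diff\<close>)
      also have "(\<Sum>S\<in>Q (a = 1). ?g S) + (\<Sum>S\<in>Q (a \<noteq> 1). ?g S) = (\<Sum>S\<in>Q (a = 1) \<union> Q (a \<noteq> 1). ?g S)"
        by (rule sum.union_disjoint[symmetric]) (auto simp: Q_def)
      also have "Q (a = 1) \<union> Q (a \<noteq> 1) = Pow ?X" by (auto simp: Q_def)
      finally show ?thesis using norm True by (simp add: fun_inner_def)
    next
      case False
      \<comment> \<open>Here \<open>S\<close> and \<open>T\<close> differ exactly in the element 1.
        Their cardinalities differ, so the homogeneous \<open>f\<close> vanishes at one of them, and
        likewise at one of the complements.\<close>
      have "A S T = 0" if "(S, T) \<in> ?R" for S T
      proof -
        have fin: "finite S" "finite T" using that finite_subset by auto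
        have "card S \<noteq> card T" "card (?X - S) \<noteq> card (?X - T)"
        proof -
          have "(1 \<in> S \<and> 1 \<notin> T \<and> S = insert 1 T) \<or> (1 \<in> T \<and> 1 \<notin> S \<and> T = insert 1 S)"
            using that False ab by (auto simp: less_2_cases_iff)
          then show 1: "card S \<noteq> card T" using fin by auto
          have "card S \<le> card ?X" "card T \<le> card ?X" using that by (auto simp del: card_atLeastAtMost intro!: card_mono)
          then show "card (?X - S) \<noteq> card (?X - T)"
            using 1 that fin by (auto simp: card_Diff_subset)
        qed
        then have "f S = 0 \<or> f T = 0" "f (?X - S) = 0 \<or> f (?X - T) = 0"
          using hom unfolding homogeneous_def by metis+
        then show ?thesis by (auto simp: A_def)
      qed
      then show ?thesis using False by (auto intro!: sum.neutral)
    qed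
    finally show "partial_trace n [1] \<rho> $$ (a, b) = ((1 / 2) \<cdot>\<^sub>m 1\<^sub>m 2) $$ (a, b)"
      using ab by simp
  qed (simp_all add: partial_trace_def)
  have "fidelity n (lbl a) \<rho> = 1 / 2 * sqnorm ?X f
      - 1 / 2 * Re (fun_inner ?X (perm_act (Transposition.transpose 1 (lbl a)) f) f)" for a
  proof -
    let ?t = "Transposition.transpose 1 (lbl a)"
    have a: "lbl a \<in> {2..n}" using lbl by blast
    have t: "?t permutes ?X" using a by (intro permutes_swap_id) auto
    have sub: "?t -` S \<subseteq> ?X" if "S \<subseteq> ?X" for S
      using vimage_permutes_subset[OF t] that by blast
    have "(\<Sum>S\<in>Pow ?X. qubit_kernel n \<rho> (?t -` S) S) = (\<Sum>S\<in>Pow ?X. A (?t -` S) S)"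
      using sub by (intro sum.cong) (auto simp: kern)
    \<comment> \<open>Preimages under a permutation of \<open>?X\<close> commute with complements,
      so the flipped half contributes the same sum.\<close>
    also have "\<dots> = 1 / 2 * ((\<Sum>S\<in>Pow ?X. f (?t -` S) * cnj (f S))
        + (\<Sum>S\<in>Pow ?X. f (?t -` (?X - S)) * cnj (f (?X - S))))"
      using permutes_vimage[OF t]
      by (simp add: A_def sum.distrib sum_divide_distrib add_divide_distrib vimage_Diff)
    also have "(\<Sum>S\<in>Pow ?X. f (?t -` (?X - S)) * cnj (f (?X - S))) = (\<Sum>S\<in>Pow ?X. f (?t -` S) * cnj (f S))"
      by (rule compl[of "\<lambda>S. f (?t -` S) * cnj (f S)"])
    finally have 1: "(\<Sum>S\<in>Pow ?X. qubit_kernel n \<rho> (?t -` S) S) = fun_inner ?X (perm_act ?t f) f"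
      by (simp add: fun_inner_def perm_act_def)
    have "(\<Sum>S\<in>Pow ?X. qubit_kernel n \<rho> S S) = fun_inner ?X f f"
      using trA norm by (simp add: kern)
    then show ?thesis unfolding fidelity_kernel[OF a] 1 by simp
  qed
  then show ?thesis
    unfolding admissible_fidelities_def using dens marg
    by (intro CollectI exI[of _ \<rho>]) (simp add: fidelity_form_def Finite_Cartesian_Product.vec_eq_iff)
qed

theorem theorem2:
  fixes N n :: nat
    and lbl :: "'N::finite \<Rightarrow> nat"
    and d :: "nat list \<Rightarrow> nat"
    and V :: "nat list \<Rightarrow> (nat \<Rightarrow> nat) \<Rightarrow> complex mat"
  assumes "N \<ge> 1" and "n = N + 1"
    and "CARD('N) = N" and "bij_betw lbl UNIV {2..n}"
    and "\<And>\<mu>. \<mu> \<in> two_row_partitions n \<Longrightarrow> irrep_labelled_by n \<mu> (d \<mu>) (V \<mu>)"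
  shows "admissible_fidelities n lbl =
    convex hull (\<Union>\<mu> \<in> two_row_partitions n. irrep_fidelities lbl (d \<mu>) (V \<mu>))"
proof
  have n: "1 \<le> n" using assms(2) by simp
  have lbl: "range lbl \<subseteq> {2..n}" using assms(4) by (simp add: bij_betw_def)
  then have lbl': "range lbl \<subseteq> {1..n}" by fastforce
  show "admissible_fidelities n lbl \<subseteq>
      convex hull (\<Union>\<mu> \<in> two_row_partitions n. irrep_fidelities lbl (d \<mu>) (V \<mu>))"
    using admissible_fidelities_subset[OF n lbl assms(5)] .
  show "convex hull (\<Union>\<mu> \<in> two_row_partitions n. irrep_fidelities lbl (d \<mu>) (V \<mu>)) \<subseteq>
      admissible_fidelities n lbl"
  proof (rule hull_minimal)
    show "convex (admissible_fidelities n lbl)" by (rule convex_admissible_fidelities)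
    show "(\<Union>\<mu> \<in> two_row_partitions n. irrep_fidelities lbl (d \<mu>) (V \<mu>)) \<subseteq> admissible_fidelities n lbl"
    proof (rule UN_least, rule subsetI)
      fix \<mu> y
      assume \<mu>: "\<mu> \<in> two_row_partitions n" and y: "y \<in> irrep_fidelities lbl (d \<mu>) (V \<mu>)"
      \<comment> \<open>The length of the second row is the number of digits 1 in the weight vectors
        that realise the representation.\<close>
      obtain k where k: "2 * k \<le> n" "\<mu> = two_row n k"
        using \<mu> two_row_partitions_eq[of n] n by auto
      obtain f where "homogeneous {1..n} k f" "fun_inner {1..n} f f = 1" "fidelity_form {1..n} 1 lbl f = y"
        using irrep_fidelities_homogeneous[OF n lbl' k(1) assms(5)[OF \<mu>, unfolded k(2)] y[unfolded k(2)]] .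
      then show "y \<in> admissible_fidelities n lbl"
        using homogeneous_fidelities_admissible[OF n lbl] by blast
    qed
  qed
qed

end
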